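(* Let $\mathscr{A}$ be a Banach algebra, $\eta$ be an infinite cardinal number and suppose that $\mathscr{A}$ contains a weak TI-net $\{a_\alpha:\alpha\in\Lambda\}$ of true cardinality $\eta$ (that is, $\mathrm{tr}|\Lambda|=\eta$) which is an $\ell^1(\eta)$-base (indexed by $\Lambda$ without repetitions, i.e. $a_\alpha\neq a_{\alpha'}$ for $\alpha\ne\alpha'$). (i) Then there is a bounded linear map of $\mathscr{A}^*/\mathscr{WAP}(\mathscr{A})$ onto $\ell^\infty(\eta)$. (ii) In particular, $\mathscr{A}$ is non-Arens regular. (iii) If in addition $d(\mathscr{A})=\eta$, then $\mathscr{A}$ is extremely non-Arens regular.
   Context: A bounded net $\{a_\alpha:\alpha\in\Lambda\}$ in a Banach algebra $\mathscr{A}$ is a weak TI-net if $\lim_\alpha\|a_\alpha a_\beta-a_\alpha\|=\lim_\alpha\|a_\beta a_\alpha-a_\alpha\|=0$ for each $\beta\in\Lambda$. A directed set is a set $\Lambda$ with a preorder $\preceq$ in which every pair of elements has an upper bound; $\alpha\prec\beta$ means $\alpha\preceq\beta$ and $\alpha\ne\beta$. With $\xi^+=\{\alpha\in\Lambda:\xi\prec\alpha\}$, the true cardinality of $\Lambda$ is $\mathrm{tr}|\Lambda|=\min_{\xi\in\Lambda}|\xi^+|$. $\ell^1(\eta)$-base: a bounded set $B$ of cardinality $\eta$ ($\eta$ an infinite cardinal) in a normed space is an $\ell^1(\eta)$-base if there is a constant $K>0$ with $\sum_{n=1}^p|z_n|\le K\|\sum_{n=1}^p z_nb_n\|$ for all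 $p\in\mathbb{N}$, all scalars $z_1,\dots,z_p$ and all distinct $b_1,\dots,b_p\in B$. For $f\in\mathscr{A}^*$, $\varphi\in\mathscr{A}$, $f\varphi\in\mathscr{A}^*$ is given by $\langle f\varphi,\psi\rangle=\langle f,\varphi\psi\rangle$. $\mathscr{WAP}(\mathscr{A})$ is the closed subspace of all $f\in\mathscr{A}^*$ such that $\{f\varphi:\|\varphi\|\le 1\}$ is relatively weakly compact in $\mathscr{A}^*$. $\mathscr{A}$ is Arens regular if the two Arens products on $\mathscr{A}^{**}$ coincide; by a theorem of Pym this holds iff $\mathscr{WAP}(\mathscr{A})=\mathscr{A}^*$. $\mathscr{A}$ is extremely non-Arens regular (enAr) if $\mathscr{A}^*/\mathscr{WAP}(\mathscr{A})$ contains a closed subspace that admits a surjective bounded linear map onto $\mathscr{A}^*$. $d(\mathscr{A})$ is the least cardinality of a norm-dense subset of $\mathscr{A}$. *)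

theory Defs
  imports "HOL-Analysis.Analysis"
begin

unbundle cardinal_syntax

section \<open>Scalars and Banach algebras\<close>

text \<open>The scalar field is \<open>\<real>\<close> or \<open>\<complex>\<close>; the class lets one development treat both.\<close>

class real_or_complex = real_normed_field +
  assumes real_or_complex:
    "(\<forall>x. \<exists>r. x = r *\<^sub>R 1) \<or> (\<exists>i. i * i = - 1 \<and> (\<forall>x. \<exists>r s. x = r *\<^sub>R 1 + s *\<^sub>R i))"

instance real :: real_or_complex
  by standard auto

instance complex :: real_or_complex
proof
  have "x = Re x *\<^sub>R 1 + Im x *\<^sub>R \<i>" for x
    by (simp add: complex_eq_iff)
  then show "(\<forall>x::complex. \<exists>r. x = r *\<^sub>R 1) \<or>
      (\<exists>i::complex. i * i = - 1 \<and> (\<forall>x. \<exists>r s. x = r *\<^sub>R 1 + s *\<^sub>R i))"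
    using i_squared by blast
qed

text \<open>A not necessarily unital Banach algebra over \<open>'k\<close>. The type classes supply the ring, the
  complete submultiplicative norm and the underlying real space; \<open>scl\<close> is the \<open>'k\<close>-structure.\<close>

locale banach_algebra = vector_space scl
  for scl :: "'k::real_or_complex \<Rightarrow> 'a::{real_normed_algebra,banach} \<Rightarrow> 'a" +
  assumes scale_of_real: "scl (of_real r) x = r *\<^sub>R x"
    and norm_scale: "norm (scl c x) = norm c * norm x"
    and scale_mult_left: "scl c x * y = scl c (x * y)"
    and scale_mult_right: "x * scl c y = scl c (x * y)"

section \<open>Normed spaces over the scalar field\<close>

text \<open>The library has neither normed spaces over \<open>'k\<close> nor their quotients, so normed spaces are
  carried by a record. The operations matter only on the carrier.\<close>

record ('k, 'v) normed_space =
  carrier :: "'v set"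
  add :: "'v \<Rightarrow> 'v \<Rightarrow> 'v"
  smul :: "'k \<Rightarrow> 'v \<Rightarrow> 'v"
  nrm :: "'v \<Rightarrow> real"

definition space_of :: "('k \<Rightarrow> 'v \<Rightarrow> 'v) \<Rightarrow> ('k, 'v::real_normed_vector) normed_space" where
  "space_of scl = \<lparr>carrier = UNIV, add = (+), smul = scl, nrm = norm\<rparr>"

definition scalars :: "('k, 'k::real_or_complex) normed_space" where
  "scalars = space_of (*)"

definition bounded_linear_map ::
    "('k, 'v) normed_space \<Rightarrow> ('k, 'w) normed_space \<Rightarrow> ('v \<Rightarrow> 'w) \<Rightarrow> bool" where
  "bounded_linear_map X Y T \<longleftrightarrow>
     T \<in> carrier X \<rightarrow> carrier Y \<and>
     (\<forall>x\<in>carrier X. \<forall>y\<in>carrier X. T (add X x y) = add Y (T x) (T y)) \<and>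
     (\<forall>c. \<forall>x\<in>carrier X. T (smul X c x) = smul Y c (T x)) \<and>
     (\<exists>M. \<forall>x\<in>carrier X. nrm Y (T x) \<le> M * nrm X x)"

definition dual :: "('k::real_or_complex, 'v) normed_space \<Rightarrow> ('k, 'v \<Rightarrow> 'k) normed_space" where
  "dual X =
     \<lparr>carrier = {f \<in> extensional (carrier X). bounded_linear_map X scalars f},
      add = (\<lambda>f g. \<lambda>x\<in>carrier X. f x + g x),
      smul = (\<lambda>c f. \<lambda>x\<in>carrier X. c * f x),
      nrm = (\<lambda>f. Sup {norm (f x) | x. x \<in> carrier X \<and> nrm X x \<le> 1})\<rparr>"

definition weak_topology :: "('k::real_or_complex, 'v) normed_space \<Rightarrow> 'v topology" where
  "weak_topology X =
     topology_generated_by {{x \<in> carrier X. F x \<in> U} | F U. F \<in> carrier (dual X) \<and> open U}"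

definition relatively_weakly_compact ::
    "('k::real_or_complex, 'v) normed_space \<Rightarrow> 'v set \<Rightarrow> bool" where
  "relatively_weakly_compact X S \<longleftrightarrow>
     S \<subseteq> carrier X \<and> compactin (weak_topology X) (weak_topology X closure_of S)"

definition closed_subspace :: "('k::real_or_complex, 'v) normed_space \<Rightarrow> 'v set \<Rightarrow> bool" where
  "closed_subspace X S \<longleftrightarrow>
     S \<subseteq> carrier X \<and> S \<noteq> {} \<and>
     (\<forall>x\<in>S. \<forall>y\<in>S. add X x y \<in> S) \<and> (\<forall>c. \<forall>x\<in>S. smul X c x \<in> S) \<and>
     (\<forall>x\<in>carrier X. (\<forall>e>0. \<exists>s\<in>S. nrm X (add X x (smul X (- 1) s)) < e) \<longrightarrow> x \<in> S)"

text \<open>Elements of the quotient are cosets. In \<open>smul\<close> the summand \<open>w\<close> is there for the scalar 0.\<close>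

definition quotient_space ::
    "('k, 'v) normed_space \<Rightarrow> 'v set \<Rightarrow> ('k, 'v set) normed_space" where
  "quotient_space X W =
     \<lparr>carrier = {{add X x w | w. w \<in> W} | x. x \<in> carrier X},
      add = (\<lambda>P Q. {add X p q | p q. p \<in> P \<and> q \<in> Q}),
      smul = (\<lambda>c P. {add X (smul X c p) w | p w. p \<in> P \<and> w \<in> W}),
      nrm = (\<lambda>P. Inf (nrm X ` P))\<rparr>"

definition linf :: "'i set \<Rightarrow> ('k::real_or_complex, 'i \<Rightarrow> 'k) normed_space" where
  "linf I =
     \<lparr>carrier = {x \<in> extensional I. bounded (x ` I)},
      add = (\<lambda>x y. \<lambda>i\<in>I. x i + y i),
      smul = (\<lambda>c x. \<lambda>i\<in>I. c * x i),
      nrm = (\<lambda>x. SUP i\<in>I. norm (x i))\<rparr>"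

section \<open>Cardinals and directed sets\<close>

definition least_card :: "'a set set \<Rightarrow> 'a rel" where
  "least_card C = card_of (SOME S. S \<in> C \<and> (\<forall>T\<in>C. card_of S \<le>o card_of T))"

lemma least_card_attained:
  assumes "C \<noteq> {}"
  shows "\<exists>S\<in>C. least_card C = card_of S \<and> (\<forall>T\<in>C. card_of S \<le>o card_of T)"
proof -
  have "\<exists>r\<in>card_of ` C. \<forall>r'\<in>card_of ` C. r \<le>o r'"
    using assms by (intro exists_minim_Card_order) (auto simp: card_of_Card_order)
  then have "\<exists>S. S \<in> C \<and> (\<forall>T\<in>C. card_of S \<le>o card_of T)" by auto
  from someI_ex[OF this] show ?thesis unfolding least_card_def by auto
qed

definition directed_set :: "'l set \<Rightarrow> 'l rel \<Rightarrow> bool" where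
  "directed_set L le \<longleftrightarrow>
     preorder_on L le \<and> (\<forall>\<alpha>\<in>L. \<forall>\<beta>\<in>L. \<exists>\<gamma>\<in>L. (\<alpha>, \<gamma>) \<in> le \<and> (\<beta>, \<gamma>) \<in> le)"

definition strict_upper :: "'l set \<Rightarrow> 'l rel \<Rightarrow> 'l \<Rightarrow> 'l set" where
  "strict_upper L le \<xi> = {\<alpha>\<in>L. (\<xi>, \<alpha>) \<in> le \<and> \<xi> \<noteq> \<alpha>}"

definition true_card :: "'l set \<Rightarrow> 'l rel \<Rightarrow> 'l rel" where
  "true_card L le = least_card (strict_upper L le ` L)"

definition density_character :: "'a::topological_space itself \<Rightarrow> 'a rel" where
  "density_character _ = least_card {D :: 'a set. closure D = UNIV}"

text \<open>The filter of tails of the directed set \<open>L\<close>; limits of nets are limits along it.\<close>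

definition tails :: "'l set \<Rightarrow> 'l rel \<Rightarrow> 'l filter" where
  "tails L le = (INF \<xi>\<in>L. principal {\<alpha>\<in>L. (\<xi>, \<alpha>) \<in> le})"

definition weak_TI_net :: "'l set \<Rightarrow> 'l rel \<Rightarrow> ('l \<Rightarrow> 'a::real_normed_algebra) \<Rightarrow> bool" where
  "weak_TI_net L le a \<longleftrightarrow>
     directed_set L le \<and> bounded (a ` L) \<and>
     (\<forall>\<beta>\<in>L. ((\<lambda>\<alpha>. norm (a \<alpha> * a \<beta> - a \<alpha>)) \<longlongrightarrow> 0) (tails L le) \<and>
            ((\<lambda>\<alpha>. norm (a \<beta> * a \<alpha> - a \<alpha>)) \<longlongrightarrow> 0) (tails L le))"

definition l1_base ::
    "('k::real_or_complex \<Rightarrow> 'a::real_normed_vector \<Rightarrow> 'a) \<Rightarrow> 'i rel \<Rightarrow> 'a set \<Rightarrow> bool" where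
  "l1_base scl \<eta> B \<longleftrightarrow>
     bounded B \<and> card_of B =o \<eta> \<and>
     (\<exists>K>0. \<forall>(p::nat) (z::nat \<Rightarrow> 'k) b. b ` {1..p} \<subseteq> B \<and> inj_on b {1..p} \<longrightarrow>
        (\<Sum>n=1..p. norm (z n)) \<le> K * norm (\<Sum>n=1..p. scl (z n) (b n)))"

section \<open>Weakly almost periodic functionals and Arens regularity\<close>

abbreviation Dual :: "('k::real_or_complex \<Rightarrow> 'a::real_normed_vector \<Rightarrow> 'a) \<Rightarrow>
    ('k, 'a \<Rightarrow> 'k) normed_space" where
  "Dual scl \<equiv> dual (space_of scl)"

abbreviation Bidual :: "('k::real_or_complex \<Rightarrow> 'a::real_normed_vector \<Rightarrow> 'a) \<Rightarrow>
    ('k, ('a \<Rightarrow> 'k) \<Rightarrow> 'k) normed_space" where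
  "Bidual scl \<equiv> dual (Dual scl)"

definition functional_act :: "('a::times \<Rightarrow> 'k) \<Rightarrow> 'a \<Rightarrow> ('a \<Rightarrow> 'k)" where
  "functional_act f \<phi> = (\<lambda>\<psi>. f (\<phi> * \<psi>))"

definition act_functional :: "'a::times \<Rightarrow> ('a \<Rightarrow> 'k) \<Rightarrow> ('a \<Rightarrow> 'k)" where
  "act_functional \<phi> f = (\<lambda>\<psi>. f (\<psi> * \<phi>))"

definition WAP :: "('k::real_or_complex \<Rightarrow> 'a::real_normed_algebra \<Rightarrow> 'a) \<Rightarrow> ('a \<Rightarrow> 'k) set" where
  "WAP scl = {f \<in> carrier (Dual scl).
     relatively_weakly_compact (Dual scl) {functional_act f \<phi> | \<phi>. norm \<phi> \<le> 1}}"

text \<open>First product: \<open>\<langle>\<Phi> \<box> \<Psi>, f\<rangle> = \<langle>\<Phi>, \<Psi> f\<rangle>\<close> with \<open>\<langle>\<Psi> f, \<phi>\<rangle> = \<langle>\<Psi>, f \<phi>\<rangle>\<close>.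
  Second product: \<open>\<langle>\<Phi> \<diamond> \<Psi>, f\<rangle> = \<langle>\<Psi>, f \<Phi>\<rangle>\<close> with \<open>\<langle>f \<Phi>, \<phi>\<rangle> = \<langle>\<Phi>, \<phi> f\<rangle>\<close>.\<close>

definition arens1 :: "('k::real_or_complex \<Rightarrow> 'a::real_normed_algebra \<Rightarrow> 'a) \<Rightarrow>
    (('a \<Rightarrow> 'k) \<Rightarrow> 'k) \<Rightarrow> (('a \<Rightarrow> 'k) \<Rightarrow> 'k) \<Rightarrow> (('a \<Rightarrow> 'k) \<Rightarrow> 'k)" where
  "arens1 scl \<Phi> \<Psi> = (\<lambda>f\<in>carrier (Dual scl). \<Phi> (\<lambda>\<phi>. \<Psi> (functional_act f \<phi>)))"

definition arens2 :: "('k::real_or_complex \<Rightarrow> 'a::real_normed_algebra \<Rightarrow> 'a) \<Rightarrow>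
    (('a \<Rightarrow> 'k) \<Rightarrow> 'k) \<Rightarrow> (('a \<Rightarrow> 'k) \<Rightarrow> 'k) \<Rightarrow> (('a \<Rightarrow> 'k) \<Rightarrow> 'k)" where
  "arens2 scl \<Phi> \<Psi> = (\<lambda>f\<in>carrier (Dual scl). \<Psi> (\<lambda>\<phi>. \<Phi> (act_functional \<phi> f)))"

definition arens_regular :: "('k::real_or_complex \<Rightarrow> 'a::real_normed_algebra \<Rightarrow> 'a) \<Rightarrow> bool" where
  "arens_regular scl \<longleftrightarrow>
     (\<forall>\<Phi>\<in>carrier (Bidual scl). \<forall>\<Psi>\<in>carrier (Bidual scl). arens1 scl \<Phi> \<Psi> = arens2 scl \<Phi> \<Psi>)"

definition extremely_non_arens_regular ::
    "('k::real_or_complex \<Rightarrow> 'a::real_normed_algebra \<Rightarrow> 'a) \<Rightarrow> bool" where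
  "extremely_non_arens_regular scl \<longleftrightarrow>
     (\<exists>S. closed_subspace (quotient_space (Dual scl) (WAP scl)) S \<and>
       (\<exists>T. bounded_linear_map (quotient_space (Dual scl) (WAP scl)\<lparr>carrier := S\<rparr>)
              (Dual scl) T \<and> T ` S = carrier (Dual scl)))"

end

theory Submission
  imports Defs
begin

text \<open>Let \<open>f\<close> be weakly almost periodic and let \<open>b\<close>, \<open>c\<close> be two subnets of the TI-net. The iterated limits
  of \<open>f (b \<zeta> * c \<xi>)\<close> are \<open>lim f (c \<xi>)\<close> and \<open>lim f (b \<zeta>)\<close>, so weak compactness of the orbit of \<open>f\<close> makes
  these two limits equal. As every tail has \<open>\<eta>\<close> elements, the net has \<open>\<eta>\<close> disjoint cofinal subnets,
  one of which serves as base point; the differences of the limits of \<open>f\<close> along the others and along the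
  base point form a bounded map into \<open>\<ell>\<^sup>\<infinity>(\<eta>)\<close> that vanishes on the weakly almost periodic functionals. It
  is onto because a bounded function on an \<open>\<ell>\<^sup>1\<close>-base extends to a functional. The weak* limits
  \<open>\<Phi>\<close>, \<open>\<Psi>\<close> of two subnets in the bidual satisfy \<open>\<Phi> \<box> \<Psi> = \<Psi>\<close> and \<open>\<Phi> \<diamond> \<Psi> = \<Phi>\<close>, which refutes Arens
  regularity. If the density character is \<open>\<eta>\<close>, then the dual embeds isometrically into
  \<open>\<ell>\<^sup>\<infinity>(\<eta>)\<close>, and the preimage of this copy is the subspace required for extreme non-Arens
  regularity.\<close>

section \<open>Ultrafilters\<close>

text \<open>All the limits must exist for every functional at once and depend linearly on it. A
  single ultrafilter \<open>U\<close> finer than the tails provides this: bounded scalar functions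
  converge along \<open>U\<close>, and their limits are additive and homogeneous. A subnet is
  encoded as a map \<open>\<xi> \<mapsto> y \<xi> j\<close> on the same index set \<open>L\<close>
  with \<open>y \<xi> j\<close> strictly above \<open>\<xi>\<close>. Such a map runs into every tail
  by itself, so all subnets share \<open>U\<close> and iterated limits are taken along
  \<open>U\<close> twice. The cardinals enter through the disjoint choice. The base condition and
  injectivity of the net give \<open>|L| = \<eta>\<close>, so there are only \<eta> pairs of an
  index and a slot, while every tail offers at least \<eta> values. Both halves of the TI condition
  are used: multiplying a moving \<open>c \<xi>\<close> on the left by a fixed
  \<open>b \<zeta>\<close> gives one iterated limit, and multiplying a moving
  \<open>b \<zeta>\<close> on the right by a fixed \<open>c \<xi>\<close> gives the other.\<close>

definition ultrafilter :: "'a filter \<Rightarrow> bool" where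
  "ultrafilter U \<longleftrightarrow> U \<noteq> bot \<and> (\<forall>P. eventually P U \<or> eventually (\<lambda>x. \<not> P x) U)"

text \<open>Zorn's lemma in the reversed order: the infimum of a chain of proper filters is proper,
  since a property holding eventually for it already does so for a member. A minimal proper filter
  decides every \<open>P\<close>: unless it contains the complement, intersecting it with
  \<open>P\<close> stays proper and so changes nothing.\<close>

lemma ultrafilter_finer_exists:
  assumes "F \<noteq> bot"
  shows "\<exists>U. ultrafilter U \<and> U \<le> F"
proof -
  let ?A = "{G. G \<noteq> bot \<and> G \<le> F}" and ?P = "\<lambda>G H :: 'a filter. H \<le> G"
  have "\<exists>m\<in>?A. \<forall>a\<in>?A. ?P m a \<longrightarrow> a = m"
  proof (rule predicate_Zorn)
    show "partial_order_on ?A (relation_of ?P ?A)"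
      by (rule partial_order_on_relation_ofI) auto
  next
    fix C assume C: "C \<in> Chains (relation_of ?P ?A)"
    then have total: "G \<le> H \<or> H \<le> G" if "G \<in> C" "H \<in> C" for G H
      using that by (auto simp: Chains_def relation_of_def)
    have CA: "C \<subseteq> ?A" using C by (auto simp: Chains_def relation_of_def)
    show "\<exists>u\<in>?A. \<forall>a\<in>C. u \<le> a"
    proof (cases "C = {}")
      case True
      then show ?thesis using assms by auto
    next
      case False
      have "eventually P (Inf C) \<longleftrightarrow> (\<exists>G\<in>C. eventually P G)" for P
        by (rule eventually_Inf_base[OF False]) (metis total inf.absorb1 inf.absorb2 order_refl)
      then have nontrivial: "Inf C \<noteq> bot"
        using CA by (force simp: trivial_limit_def)
      obtain G where "G \<in> C" using False by blast
      then have "Inf C \<le> F"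
        using CA by (intro Inf_lower2[of G]) auto
      with nontrivial show ?thesis by (auto intro: Inf_lower)
    qed
  qed
  then obtain U where U: "U \<noteq> bot" "U \<le> F" and min: "\<And>G. G \<noteq> bot \<Longrightarrow> G \<le> U \<Longrightarrow> G = U"
    by (auto intro: order_trans)
  have "eventually P U \<or> eventually (\<lambda>x. \<not> P x) U" for P
  proof (rule disjCI)
    assume "\<not> eventually (\<lambda>x. \<not> P x) U"
    then have "inf U (principal {x. P x}) \<noteq> bot"
      by (auto simp: trivial_limit_def eventually_inf_principal)
    then have "inf U (principal {x. P x}) = U" by (rule min) simp
    moreover have "eventually P (inf U (principal {x. P x}))"
      by (simp add: eventually_inf_principal)
    ultimately show "eventually P U" by simp
  qed
  with U show ?thesis by (auto simp: ultrafilter_def)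
qed

text \<open>For an ultrafilter, not being eventually in a set means being eventually outside it. If
  no point of \<open>C\<close> were a limit, each would have a neighbourhood that \<open>f\<close>
  eventually avoids, and a finite subcover would make \<open>f\<close> avoid
  \<open>C\<close>.\<close>

lemma ultrafilter_limitin_compactin:
  assumes U: "ultrafilter U" and C: "compactin X C" and f: "eventually (\<lambda>x. f x \<in> C) U"
  shows "\<exists>g\<in>C. limitin X f g U"
proof (rule ccontr)
  assume contra: "\<not> ?thesis"
  have "\<exists>N. openin X N \<and> g \<in> N \<and> eventually (\<lambda>x. f x \<notin> N) U" if "g \<in> C" for g
  proof -
    have "g \<in> topspace X" using C that compactin_subset_topspace by blast
    with contra that obtain N where "openin X N" "g \<in> N" "\<not> eventually (\<lambda>x. f x \<in> N) U"
      by (auto simp: limitin_def)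
    with U show ?thesis unfolding ultrafilter_def by blast
  qed
  then obtain N where N: "\<And>g. g \<in> C \<Longrightarrow> openin X (N g) \<and> g \<in> N g \<and> eventually (\<lambda>x. f x \<notin> N g) U"
    by metis
  have "\<exists>\<F>. finite \<F> \<and> \<F> \<subseteq> N ` C \<and> C \<subseteq> \<Union>\<F>"
    by (rule compactinD[OF C]) (use N in auto)
  then obtain D where D: "finite D" "D \<subseteq> C" "C \<subseteq> \<Union>(N ` D)"
    by (metis finite_subset_image)
  have "eventually (\<lambda>x. \<forall>g\<in>D. f x \<notin> N g) U"
    using D N by (intro eventually_ball_finite) auto
  with f have "eventually (\<lambda>x. False) U"
    by eventually_elim (use D in blast)
  with U show False by (simp add: ultrafilter_def)
qed

section \<open>The scalar field\<close>

text \<open>In the complex case \<open>r\<^sup>2 + s\<^sup>2 = (r + s i) (r - s i)\<close> bounds the coordinates by the norm.\<close>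

lemma imaginary_unit_coordinates_le:
  fixes i :: "'k::real_normed_field"
  assumes "i * i = - 1"
  shows "\<bar>r\<bar> + \<bar>s\<bar> \<le> 2 * norm (r *\<^sub>R 1 + s *\<^sub>R i)"
proof -
  let ?n = "norm (r *\<^sub>R 1 + s *\<^sub>R i)"
  have "norm i * norm i = 1"
    using assms by (metis norm_minus_cancel norm_mult norm_one)
  then have i: "norm i = 1"
    using abs_square_eq_1[of "norm i"] by (simp add: power2_eq_square)
  have "(r *\<^sub>R 1 + s *\<^sub>R i) * (r *\<^sub>R 1 - s *\<^sub>R i) = (r * r) *\<^sub>R 1 - (s * s) *\<^sub>R (i * i)"
    by (simp add: algebra_simps)
  also have "\<dots> = of_real (r\<^sup>2 + s\<^sup>2)"
    using assms by (simp add: of_real_def power2_eq_square algebra_simps)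
  finally have "norm ((r *\<^sub>R 1 + s *\<^sub>R i) * (r *\<^sub>R 1 - s *\<^sub>R i)) = \<bar>r\<^sup>2 + s\<^sup>2\<bar>"
    by (metis norm_of_real)
  then have "r\<^sup>2 + s\<^sup>2 = ?n * norm (r *\<^sub>R 1 - s *\<^sub>R i)"
    by (simp add: norm_mult)
  also have "norm (r *\<^sub>R 1 - s *\<^sub>R i) \<le> \<bar>r\<bar> + \<bar>s\<bar>"
    using norm_triangle_ineq4[of "r *\<^sub>R 1" "s *\<^sub>R i"] i by simp
  then have "?n * norm (r *\<^sub>R 1 - s *\<^sub>R i) \<le> ?n * (\<bar>r\<bar> + \<bar>s\<bar>)"
    by (simp add: mult_left_mono)
  finally have *: "r\<^sup>2 + s\<^sup>2 \<le> ?n * (\<bar>r\<bar> + \<bar>s\<bar>)" .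
  have "0 \<le> (\<bar>r\<bar> - \<bar>s\<bar>)\<^sup>2" by simp
  then have "(\<bar>r\<bar> + \<bar>s\<bar>)\<^sup>2 \<le> 2 * (r\<^sup>2 + s\<^sup>2)"
    by (simp add: power2_sum power2_diff)
  with * have **: "(\<bar>r\<bar> + \<bar>s\<bar>) * (\<bar>r\<bar> + \<bar>s\<bar>) \<le> (2 * ?n) * (\<bar>r\<bar> + \<bar>s\<bar>)"
    by (simp add: power2_eq_square algebra_simps)
  show ?thesis
  proof (cases "\<bar>r\<bar> + \<bar>s\<bar> \<le> 0")
    case True
    then show ?thesis using norm_ge_zero[of "r *\<^sub>R 1 + s *\<^sub>R i"] by linarith
  next
    case False
    then have "0 < \<bar>r\<bar> + \<bar>s\<bar>" by linarith
    with ** show ?thesis by (rule mult_right_le_imp_le)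
  qed
qed

text \<open>Every ball of \<open>'k\<close> lies in a compact set, the continuous image of an
  interval or a square of real coordinates. The side \<open>2 * C\<close> is the coordinate bound of
  \<open>imaginary_unit_coordinates_le\<close>.\<close>

lemma ultrafilter_bounded_convergent:
  fixes f :: "'b \<Rightarrow> 'k::real_or_complex"
  assumes U: "ultrafilter U" and f: "eventually (\<lambda>x. norm (f x) \<le> C) U"
  shows "(f \<longlongrightarrow> Lim U f) U"
proof -
  have "\<exists>K :: 'k set. compact K \<and> (\<forall>x. norm x \<le> C \<longrightarrow> x \<in> K)"
    using real_or_complex
  proof
    assume *: "\<forall>x :: 'k. \<exists>r. x = r *\<^sub>R 1"
    have "compact ((\<lambda>r. r *\<^sub>R (1 :: 'k)) ` cball 0 C)"
      by (intro compact_continuous_image continuous_intros) auto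
    moreover have "x \<in> (\<lambda>r. r *\<^sub>R (1 :: 'k)) ` cball 0 C" if "norm x \<le> C" for x
      using *[rule_format, of x] that by auto
    ultimately show ?thesis by blast
  next
    assume "\<exists>i :: 'k. i * i = - 1 \<and> (\<forall>x. \<exists>r s. x = r *\<^sub>R 1 + s *\<^sub>R i)"
    then obtain i :: 'k where i: "i * i = - 1" "\<And>x. \<exists>r s. x = r *\<^sub>R 1 + s *\<^sub>R i" by blast
    let ?g = "\<lambda>(r, s). r *\<^sub>R 1 + s *\<^sub>R i" and ?I = "cball 0 (2 * C) :: real set"
    have "compact (?g ` (?I \<times> ?I))"
      by (intro compact_continuous_image compact_Times)
        (auto simp: case_prod_beta intro!: continuous_intros)
    moreover have "x \<in> ?g ` (?I \<times> ?I)" if x: "norm x \<le> C" for x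
    proof -
      obtain r s where "x = r *\<^sub>R 1 + s *\<^sub>R i" using i(2) by blast
      moreover from this have "\<bar>r\<bar> + \<bar>s\<bar> \<le> 2 * C"
        using imaginary_unit_coordinates_le[OF i(1), of r s] x by auto
      ultimately show ?thesis by (intro image_eqI[of _ _ "(r, s)"]) auto
    qed
    ultimately show ?thesis by blast
  qed
  then obtain K :: "'k set" where K: "compact K" "\<And>x. norm x \<le> C \<Longrightarrow> x \<in> K" by blast
  have "compactin euclidean K" using K by simp
  moreover have "eventually (\<lambda>x. f x \<in> K) U"
    using f by eventually_elim (rule K)
  ultimately obtain g where "limitin euclidean f g U"
    using ultrafilter_limitin_compactin[OF U] by blast
  then have "(f \<longlongrightarrow> g) U" by simp
  then show ?thesis using U by (metis tendsto_Lim ultrafilter_def)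
qed

section \<open>The Hahn--Banach theorem\<close>

text \<open>Homogeneity is required as an inequality only, the form that infima inherit; applying it
  to \<open>inverse t\<close> recovers equality in \<open>sublinear_scaleR\<close>.\<close>

definition sublinear :: "('a::real_vector \<Rightarrow> real) \<Rightarrow> bool" where
  "sublinear p \<longleftrightarrow> (\<forall>x y. p (x + y) \<le> p x + p y) \<and> (\<forall>t x. 0 < t \<longrightarrow> p (t *\<^sub>R x) \<le> t * p x)"

lemma sublinear_scaleR:
  assumes "sublinear p" "0 < t"
  shows "p (t *\<^sub>R x) = t * p x"
proof -
  have "p (inverse t *\<^sub>R t *\<^sub>R x) \<le> inverse t * p (t *\<^sub>R x)"
    using assms unfolding sublinear_def by (metis inverse_positive_iff_positive)
  then have "t * p x \<le> p (t *\<^sub>R x)"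
    using assms by (simp add: field_simps)
  with assms show ?thesis unfolding sublinear_def by (metis antisym)
qed

lemma sublinear_zero: "sublinear p \<Longrightarrow> p 0 = 0"
  using sublinear_scaleR[of p 2 0] by simp

lemma sublinear_minus_le: "sublinear p \<Longrightarrow> - p (- x) \<le> p x"
  using sublinear_zero[of p] unfolding sublinear_def by (metis add.right_inverse minus_le_iff real_0_le_add_iff)

text \<open>Replacing \<open>q y\<close> by the infimum of \<open>q (y + t z) - t q z\<close> over \<open>t \<ge> 0\<close> keeps \<open>q\<close> sublinear, so by
  minimality it changes nothing.\<close>

lemma minimal_sublinear_linear:
  assumes q: "sublinear q" and min: "\<And>r. sublinear r \<Longrightarrow> r \<le> q \<Longrightarrow> r = q"
  shows "linear q"
proof -
  have add: "q (x + z) = q x + q z" for x z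
  proof (rule antisym)
    show "q (x + z) \<le> q x + q z" using q by (simp add: sublinear_def)
  next
    define V where "V y = {q (y + t *\<^sub>R z) - t * q z | t. 0 \<le> t}" for y
    define r where "r y = Inf (V y)" for y
    \<comment> \<open>This lower bound makes the infimum \<open>r y\<close> a genuine one.\<close>
    have V_ge: "- q (- y) \<le> v" if v: "v \<in> V y" for v y
    proof -
      obtain t where t: "0 \<le> t" "v = q (y + t *\<^sub>R z) - t * q z" using v by (auto simp: V_def)
      have tz: "q (t *\<^sub>R z) = t * q z"
        using t sublinear_scaleR[OF q] sublinear_zero[OF q] by (cases "t = 0") auto
      have "q ((y + t *\<^sub>R z) + - y) \<le> q (y + t *\<^sub>R z) + q (- y)"
        using q unfolding sublinear_def by blast
      then show ?thesis using t tz by simp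
    qed
    then have bdd: "bdd_below (V y)" for y by (meson bdd_below.I)
    have ne: "V y \<noteq> {}" for y by (auto simp: V_def)
    have r_le: "r y \<le> q (y + t *\<^sub>R z) - t * q z" if "0 \<le> t" for y t
      unfolding r_def by (rule cInf_lower[OF _ bdd]) (use that in \<open>auto simp: V_def\<close>)
    have "sublinear r"
      unfolding sublinear_def
    proof (intro conjI allI impI)
      fix x y
      have "r (x + y) - v \<le> w" if v: "v \<in> V x" and w: "w \<in> V y" for v w
      proof -
        obtain t where t: "0 \<le> t" "v = q (x + t *\<^sub>R z) - t * q z" using v by (auto simp: V_def)
        obtain s where s: "0 \<le> s" "w = q (y + s *\<^sub>R z) - s * q z" using w by (auto simp: V_def)
        have "r (x + y) \<le> q ((x + y) + (t + s) *\<^sub>R z) - (t + s) * q z"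
          using t s by (intro r_le) auto
        also have "(x + y) + (t + s) *\<^sub>R z = (x + t *\<^sub>R z) + (y + s *\<^sub>R z)"
          by (simp add: algebra_simps)
        also have "q \<dots> \<le> q (x + t *\<^sub>R z) + q (y + s *\<^sub>R z)"
          using q by (simp add: sublinear_def)
        finally show ?thesis using t s by (simp add: algebra_simps)
      qed
      then have *: "r (x + y) - v \<le> r y" if "v \<in> V x" for v
        using that unfolding r_def[of y] by (intro cInf_greatest[OF ne]) auto
      have "r (x + y) - r y \<le> v" if "v \<in> V x" for v using *[OF that] by linarith
      then have "r (x + y) - r y \<le> r x"
        unfolding r_def[of x] by (intro cInf_greatest[OF ne]) auto
      then show "r (x + y) \<le> r x + r y" by simp
    next
      fix s :: real and x assume s: "0 < s"
      have "r (s *\<^sub>R x) / s \<le> v" if v: "v \<in> V x" for v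
      proof -
        obtain t where t: "0 \<le> t" "v = q (x + t *\<^sub>R z) - t * q z" using v by (auto simp: V_def)
        have "r (s *\<^sub>R x) \<le> q (s *\<^sub>R x + (s * t) *\<^sub>R z) - (s * t) * q z"
          using t s by (intro r_le) auto
        also have "s *\<^sub>R x + (s * t) *\<^sub>R z = s *\<^sub>R (x + t *\<^sub>R z)"
          by (simp add: algebra_simps)
        also have "q \<dots> = s * q (x + t *\<^sub>R z)" by (rule sublinear_scaleR[OF q s])
        finally have "r (s *\<^sub>R x) \<le> s * v" by (simp add: t(2) algebra_simps)
        then show ?thesis using s by (simp add: field_simps)
      qed
      then have "r (s *\<^sub>R x) / s \<le> r x"
        unfolding r_def[of x] by (intro cInf_greatest[OF ne]) auto
      then show "r (s *\<^sub>R x) \<le> s * r x" using s by (simp add: field_simps)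
    qed
    moreover have "r \<le> q" using r_le[of 0] by (simp add: le_fun_def)
    ultimately have "r = q" by (rule min)
    with r_le[of 1 x] show "q x + q z \<le> q (x + z)" by simp
  qed
  have neg: "q (- x) = - q x" for x
    using add[of x "- x"] sublinear_zero[OF q] by simp
  show ?thesis
  proof (rule linearI)
    show "q (t *\<^sub>R x) = t *\<^sub>R q x" for t x
    proof (cases t "0 :: real" rule: linorder_cases)
      case less
      then have "q ((- t) *\<^sub>R x) = (- t) * q x" by (intro sublinear_scaleR[OF q]) auto
      then show ?thesis using neg[of "t *\<^sub>R x"] by simp
    qed (use sublinear_scaleR[OF q] sublinear_zero[OF q] in auto)
  qed (rule add)
qed

text \<open>Zorn's lemma downwards, the minimal elements being linear. The pointwise infimum of a
  chain below \<open>p\<close> is finite because each member is at least \<open>- p (- x)\<close>.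
  It is subadditive because two members of a chain can be replaced by the smaller one.\<close>

lemma sublinear_dominates_linear:
  assumes p: "sublinear p"
  shows "\<exists>f. linear f \<and> f \<le> p"
proof -
  let ?A = "{q. sublinear q \<and> q \<le> p}" and ?P = "\<lambda>q r :: 'a \<Rightarrow> real. r \<le> q"
  have "\<exists>m\<in>?A. \<forall>a\<in>?A. ?P m a \<longrightarrow> a = m"
  proof (rule predicate_Zorn)
    show "partial_order_on ?A (relation_of ?P ?A)"
      by (rule partial_order_on_relation_ofI) auto
  next
    fix C assume C: "C \<in> Chains (relation_of ?P ?A)"
    then have total: "q \<le> r \<or> r \<le> q" if "q \<in> C" "r \<in> C" for q r
      using that by (auto simp: Chains_def relation_of_def)
    have CA: "C \<subseteq> ?A" using C by (auto simp: Chains_def relation_of_def)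
    show "\<exists>u\<in>?A. \<forall>a\<in>C. u \<le> a"
    proof (cases "C = {}")
      case True
      then show ?thesis using p by auto
    next
      case False
      define u where "u x = (INF q\<in>C. q x)" for x
      have "- p (- x) \<le> q x" if "q \<in> C" for q x
      proof -
        have "q (- x) \<le> p (- x)" "- q (- x) \<le> q x"
          using that CA sublinear_minus_le by (auto simp: le_fun_def)
        then show ?thesis by linarith
      qed
      then have bdd: "bdd_below ((\<lambda>q. q x) ` C)" for x
        by (intro bdd_belowI[of _ "- p (- x)"]) auto
      have u_le: "u x \<le> q x" if "q \<in> C" for q x
        unfolding u_def by (rule cINF_lower[OF bdd that])
      have u_ge: "c \<le> u x" if "\<And>q. q \<in> C \<Longrightarrow> c \<le> q x" for c x
        unfolding u_def by (rule cINF_greatest[OF False that])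
      have "sublinear u"
        unfolding sublinear_def
      proof (intro conjI allI impI)
        fix x y
        have *: "u (x + y) \<le> q x + r y" if qr: "q \<in> C" "r \<in> C" for q r
        proof -
          obtain s where s: "s \<in> C" "s \<le> q" "s \<le> r"
            using total[OF qr] qr by auto
          have "u (x + y) \<le> s (x + y)" using s by (intro u_le)
          also have "\<dots> \<le> s x + s y" using s CA by (auto simp: sublinear_def)
          also have "\<dots> \<le> q x + r y" using s by (auto simp: le_fun_def intro: add_mono)
          finally show ?thesis .
        qed
        have **: "u (x + y) - q x \<le> u y" if q: "q \<in> C" for q
        proof (rule u_ge)
          show "u (x + y) - q x \<le> r y" if "r \<in> C" for r using *[OF q that] by linarith
        qed
        have "u (x + y) - u y \<le> u x"
        proof (rule u_ge)
          show "u (x + y) - u y \<le> q x" if "q \<in> C" for q using **[OF that] by linarith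
        qed
        then show "u (x + y) \<le> u x + u y" by simp
      next
        fix t :: real and x assume t: "0 < t"
        have "u (t *\<^sub>R x) / t \<le> u x"
        proof (rule u_ge)
          fix q assume q: "q \<in> C"
          have "u (t *\<^sub>R x) \<le> q (t *\<^sub>R x)" by (rule u_le[OF q])
          also have "\<dots> = t * q x" using q CA t by (intro sublinear_scaleR) auto
          finally show "u (t *\<^sub>R x) / t \<le> q x" using t by (simp add: field_simps)
        qed
        then show "u (t *\<^sub>R x) \<le> t * u x" using t by (simp add: field_simps)
      qed
      moreover obtain q0 where "q0 \<in> C" using False by blast
      then have "u \<le> p" using CA u_le[of q0] by (force simp: le_fun_def intro: order_trans)
      ultimately show ?thesis using u_le by (intro bexI[of _ u]) (auto simp: le_fun_def)
    qed
  qed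
  then obtain q where q: "sublinear q" "q \<le> p"
    and min: "\<And>r. sublinear r \<Longrightarrow> r \<le> q \<Longrightarrow> r = q" by (auto intro: order_trans)
  then show ?thesis using minimal_sublinear_linear[OF q(1) min] by blast
qed

text \<open>\<open>G\<close> is the graph of the functional to be extended, and \<open>p x\<close>
  is the infimum of \<open>K * norm (x - v) + u\<close> over it. A linear \<open>f\<close> below
  \<open>p\<close> is bounded by \<open>K * norm x\<close>, by the pair \<open>(0, 0)\<close>, and
  is at most \<open>u\<close> at \<open>v\<close>. As \<open>G\<close> is closed under negation, the
  latter is an equality.\<close>

lemma hahn_banach_real:
  fixes G :: "('a::real_normed_vector \<times> real) set"
  assumes G: "subspace G" and bound: "\<And>v u. (v, u) \<in> G \<Longrightarrow> u \<le> K * norm v" and K: "0 \<le> K"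
  shows "\<exists>f. linear f \<and> (\<forall>x. \<bar>f x\<bar> \<le> K * norm x) \<and> (\<forall>(v, u)\<in>G. f v = u)"
proof -
  define V where "V x = {K * norm (x - v) + u | v u. (v, u) \<in> G}" for x
  define p where "p x = Inf (V x)" for x
  have "- K * norm x \<le> w" if w: "w \<in> V x" for w x
  proof -
    obtain v u where vu: "(v, u) \<in> G" "w = K * norm (x - v) + u" using w by (auto simp: V_def)
    have "- (v, u) \<in> G" using vu G by (intro subspace_neg)
    then have "- u \<le> K * norm v" using bound[of "- v" "- u"] by simp
    moreover have "K * norm v \<le> K * (norm (x - v) + norm x)"
      using K norm_triangle_ineq2[of v x] by (intro mult_left_mono) (auto simp: norm_minus_commute)
    ultimately show ?thesis using vu by (simp add: algebra_simps)
  qed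
  then have bdd: "bdd_below (V x)" for x by (meson bdd_below.I)
  have G0: "(0, 0) \<in> G" using subspace_0[OF G] by (simp add: zero_prod_def)
  then have ne: "V x \<noteq> {}" for x by (auto simp: V_def)
  have p_le: "p x \<le> K * norm (x - v) + u" if "(v, u) \<in> G" for x v u
    unfolding p_def by (rule cInf_lower[OF _ bdd]) (use that in \<open>auto simp: V_def\<close>)
  have p_ge: "c \<le> p x" if "\<And>v u. (v, u) \<in> G \<Longrightarrow> c \<le> K * norm (x - v) + u" for c x
    unfolding p_def by (rule cInf_greatest[OF ne]) (use that in \<open>auto simp: V_def\<close>)
  have "sublinear p"
    unfolding sublinear_def
  proof (intro conjI allI impI)
    fix x y
    have *: "p (x + y) \<le> (K * norm (x - v) + u) + (K * norm (y - v') + u')"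
      if "(v, u) \<in> G" "(v', u') \<in> G" for v u v' u'
    proof -
      have "(v + v', u + u') \<in> G" using subspace_add[OF G that] by simp
      then have "p (x + y) \<le> K * norm ((x + y) - (v + v')) + (u + u')" by (rule p_le)
      also have "(x + y) - (v + v') = (x - v) + (y - v')" by simp
      also have "K * norm \<dots> \<le> K * (norm (x - v) + norm (y - v'))"
        using K by (intro mult_left_mono norm_triangle_ineq)
      finally show ?thesis by (simp add: algebra_simps)
    qed
    have **: "p (x + y) - (K * norm (x - v) + u) \<le> p y" if vu: "(v, u) \<in> G" for v u
    proof (rule p_ge)
      show "p (x + y) - (K * norm (x - v) + u) \<le> K * norm (y - v') + u'" if "(v', u') \<in> G" for v' u'
        using *[OF vu that] by linarith
    qed
    have "p (x + y) - p y \<le> p x"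
    proof (rule p_ge)
      show "p (x + y) - p y \<le> K * norm (x - v) + u" if "(v, u) \<in> G" for v u
        using **[OF that] by linarith
    qed
    then show "p (x + y) \<le> p x + p y" by simp
  next
    fix t :: real and x assume t: "0 < t"
    have "p (t *\<^sub>R x) / t \<le> p x"
    proof (rule p_ge)
      fix v u assume "(v, u) \<in> G"
      then have "t *\<^sub>R (v, u) \<in> G" by (rule subspace_scale[OF G])
      then have "(t *\<^sub>R v, t * u) \<in> G" by simp
      then have "p (t *\<^sub>R x) \<le> K * norm (t *\<^sub>R x - t *\<^sub>R v) + t * u" by (rule p_le)
      also have "t *\<^sub>R x - t *\<^sub>R v = t *\<^sub>R (x - v)" by (simp add: algebra_simps)
      also have "norm \<dots> = t * norm (x - v)" using t by simp
      finally show "p (t *\<^sub>R x) / t \<le> K * norm (x - v) + u" using t by (simp add: field_simps)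
    qed
    then show "p (t *\<^sub>R x) \<le> t * p x" using t by (simp add: field_simps)
  qed
  from sublinear_dominates_linear[OF this] obtain f where f: "linear f" "f \<le> p" by blast
  have fp: "f x \<le> p x" for x using f by (simp add: le_fun_def)
  have neg: "f (- x) = - f x" for x using f(1) by (rule linear_neg)
  have "f x \<le> K * norm x" for x using fp[of x] p_le[OF G0, of x] by simp
  then have "\<bar>f x\<bar> \<le> K * norm x" for x
    using neg[of x] by (metis abs_le_iff norm_minus_cancel)
  moreover have le: "f v \<le> u" if "(v, u) \<in> G" for v u
    using fp[of v] p_le[OF that, of v] by simp
  have "f v = u" if "(v, u) \<in> G" for v u
  proof -
    have "- (v, u) \<in> G" using that G by (intro subspace_neg)
    then have "f (- v) \<le> - u" by (intro le) simp
    with le[OF that] neg[of v] show ?thesis by simp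
  qed
  ultimately show ?thesis using f by blast
qed

section \<open>Disjoint cofinal families\<close>

text \<open>Transfinite recursion along the cardinal well-order of \<open>I\<close>: the values used
  before stage \<open>i\<close> are indexed by a proper initial segment, so they are fewer than
  \<open>|I|\<close> and cannot exhaust \<open>A i\<close>.\<close>

lemma injective_choice:
  assumes "\<And>i. i \<in> I \<Longrightarrow> |I| \<le>o |A i|"
  shows "\<exists>g. inj_on g I \<and> (\<forall>i\<in>I. g i \<in> A i)"
proof -
  let ?r = "|I|"
  define g where "g = wfrec (?r - Id) (\<lambda>g i. SOME y. y \<in> A i \<and> y \<notin> g ` underS ?r i)"
  have wf: "wf (?r - Id)"
    using card_of_Well_order[of I] by (simp add: well_order_on_def)
  have g: "g i = (SOME y. y \<in> A i \<and> y \<notin> g ` underS ?r i)" for i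
  proof -
    have "g i = (SOME y. y \<in> A i \<and> y \<notin> cut g (?r - Id) i ` underS ?r i)"
      unfolding g_def by (subst wfrec[OF wf]) simp
    also have "cut g (?r - Id) i ` underS ?r i = g ` underS ?r i"
      by (intro image_cong refl cut_apply) (auto simp: underS_def)
    finally show ?thesis .
  qed
  have spec: "g i \<in> A i \<and> g i \<notin> g ` underS ?r i" if i: "i \<in> I" for i
  proof -
    have "|g ` underS ?r i| \<le>o |underS ?r i|" by (rule card_of_image)
    also have "|underS ?r i| <o |I|"
      by (rule card_of_underS) (use i card_of_Card_order in \<open>auto simp: Field_card_of\<close>)
    also (ordLeq_ordLess_trans) have "|I| \<le>o |A i|" using assms i by blast
    finally (ordLess_ordLeq_trans) have "|g ` underS ?r i| <o |A i|" .
    then have "\<not> A i \<subseteq> g ` underS ?r i"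
      using card_of_mono1 not_ordLess_ordLeq by blast
    then have "\<exists>y. y \<in> A i \<and> y \<notin> g ` underS ?r i" by blast
    from someI_ex[OF this] show ?thesis by (subst (1 2) g)
  qed
  have "inj_on g I"
  proof (rule inj_onI)
    fix i j assume ij: "i \<in> I" "j \<in> I" and eq: "g i = g j"
    show "i = j"
    proof (rule ccontr)
      assume "i \<noteq> j"
      then have "i \<in> underS ?r j \<or> j \<in> underS ?r i"
        using card_of_Well_order[of I] ij
        by (auto simp: well_order_on_def linear_order_on_def total_on_def underS_def Field_card_of)
      with spec[OF ij(1)] spec[OF ij(2)] eq show False by (metis imageI)
    qed
  qed
  with spec show ?thesis by blast
qed

section \<open>Dual and bidual\<close>

context banach_algebra
begin

lemma scl_scaleR_left: "scl (r *\<^sub>R c) x = r *\<^sub>R scl c x"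
  by (metis scale_of_real scale_scale scaleR_conv_of_real)

lemma scl_scaleR_right: "scl c (r *\<^sub>R x) = r *\<^sub>R scl c x"
  by (metis scale_of_real scale_scale mult.commute)

lemma carrier_Dual_iff:
  "f \<in> carrier (Dual scl) \<longleftrightarrow>
     (\<forall>x y. f (x + y) = f x + f y) \<and> (\<forall>c x. f (scl c x) = c * f x) \<and>
     (\<exists>M. \<forall>x. norm (f x) \<le> M * norm x)"
  by (auto simp: dual_def space_of_def scalars_def bounded_linear_map_def)

lemma carrier_DualI:
  assumes "\<And>x y. f (x + y) = f x + f y" "\<And>c x. f (scl c x) = c * f x"
    and "\<And>x. norm (f x) \<le> M * norm x"
  shows "f \<in> carrier (Dual scl)"
  using assms by (auto simp: carrier_Dual_iff)

lemma Dual_add: "f \<in> carrier (Dual scl) \<Longrightarrow> f (x + y) = f x + f y"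
  and Dual_scl: "f \<in> carrier (Dual scl) \<Longrightarrow> f (scl c x) = c * f x"
  by (simp_all add: carrier_Dual_iff)

lemma Dual_zero: "f \<in> carrier (Dual scl) \<Longrightarrow> f 0 = 0"
  using Dual_add[of f 0 0] by simp

lemma Dual_diff: "f \<in> carrier (Dual scl) \<Longrightarrow> f (x - y) = f x - f y"
  using Dual_add[of f "x - y" y] by simp

lemma Dual_scaleR: "f \<in> carrier (Dual scl) \<Longrightarrow> f (r *\<^sub>R x) = of_real r * f x"
  by (metis Dual_scl scale_of_real)

lemma Dual_ops [simp]:
  "add (Dual scl) f g = (\<lambda>x. f x + g x)"
  "smul (Dual scl) c f = (\<lambda>x. c * f x)"
  "nrm (Dual scl) f = Sup {norm (f x) | x. norm x \<le> 1}"
  by (auto simp: dual_def space_of_def)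

lemma Dual_norm_le:
  assumes f: "f \<in> carrier (Dual scl)"
  shows "norm (f x) \<le> nrm (Dual scl) f * norm x"
proof (cases "x = 0")
  case False
  obtain M where M: "\<And>x. norm (f x) \<le> M * norm x" using f by (auto simp: carrier_Dual_iff)
  have "norm (f x) \<le> \<bar>M\<bar>" if "norm x \<le> 1" for x
    by (rule order_trans[OF M]) (use that mult_mono[of M "\<bar>M\<bar>" "norm x" 1] in auto)
  then have "bdd_above {norm (f x) | x. norm x \<le> 1}" by (auto intro!: bdd_aboveI)
  then have "norm (f ((1 / norm x) *\<^sub>R x)) \<le> nrm (Dual scl) f"
    unfolding Dual_ops by (rule cSup_upper[rotated]) (use False in \<open>auto intro!: exI[of _ "(1 / norm x) *\<^sub>R x"]\<close>)
  then show ?thesis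
    using False by (simp add: Dual_scaleR[OF f] norm_mult norm_divide field_simps del: Dual_ops)
qed (simp add: Dual_zero[OF f])

lemma Dual_norm_least:
  assumes "\<And>x. norm (f x) \<le> B * norm x" "0 \<le> B"
  shows "nrm (Dual scl) f \<le> B"
  unfolding Dual_ops
proof (rule cSup_least)
  show "{norm (f x) | x. norm x \<le> 1} \<noteq> {}" by (auto intro!: exI[of _ 0])
next
  fix y assume "y \<in> {norm (f x) | x. norm x \<le> 1}"
  then obtain x where x: "y = norm (f x)" "norm x \<le> 1" by auto
  then have "y \<le> B * norm x" using assms(1) by simp
  also have "\<dots> \<le> B * 1" using x assms(2) by (intro mult_left_mono)
  finally show "y \<le> B" by simp
qed

lemma Dual_norm_nonneg:
  assumes f: "f \<in> carrier (Dual scl)"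
  shows "0 \<le> nrm (Dual scl) f"
proof -
  obtain M where M: "\<And>x. norm (f x) \<le> M * norm x" using f by (auto simp: carrier_Dual_iff)
  have "norm (f x) \<le> \<bar>M\<bar>" if "norm x \<le> 1" for x
    by (rule order_trans[OF M]) (use that mult_mono[of M "\<bar>M\<bar>" "norm x" 1] in auto)
  then have "bdd_above {norm (f x) | x. norm x \<le> 1}" by (auto intro!: bdd_aboveI)
  then have "norm (f 0) \<le> nrm (Dual scl) f"
    unfolding Dual_ops by (rule cSup_upper[rotated]) (auto intro!: exI[of _ 0])
  then show ?thesis by (simp add: Dual_zero[OF f] del: Dual_ops)
qed

declare Dual_ops(3) [simp del]

lemma Dual_closed:
  assumes "f \<in> carrier (Dual scl)"
  shows "g \<in> carrier (Dual scl) \<Longrightarrow> (\<lambda>x. f x + g x) \<in> carrier (Dual scl)"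
    and "(\<lambda>x. c * f x) \<in> carrier (Dual scl)"
proof -
  assume g: "g \<in> carrier (Dual scl)"
  have bd: "norm (f x + g x) \<le> (nrm (Dual scl) f + nrm (Dual scl) g) * norm x" for x
    using norm_triangle_ineq[of "f x" "g x"] Dual_norm_le[OF assms, of x] Dual_norm_le[OF g, of x]
    by (simp add: algebra_simps)
  show "(\<lambda>x. f x + g x) \<in> carrier (Dual scl)"
    by (rule carrier_DualI[OF _ _ bd]) (simp_all add: Dual_add Dual_scl assms g algebra_simps)
next
  have bd: "norm (c * f x) \<le> (norm c * nrm (Dual scl) f) * norm x" for x
    using mult_left_mono[OF Dual_norm_le[OF assms, of x], of "norm c"]
    by (simp add: norm_mult algebra_simps)
  show "(\<lambda>x. c * f x) \<in> carrier (Dual scl)"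
    by (rule carrier_DualI[OF _ _ bd]) (simp_all add: Dual_add Dual_scl assms algebra_simps)
qed

lemma zero_in_Dual: "(\<lambda>x. 0) \<in> carrier (Dual scl)"
  by (rule carrier_DualI[where M = 0]) auto

lemma carrier_Bidual_iff:
  "F \<in> carrier (Bidual scl) \<longleftrightarrow>
     F \<in> extensional (carrier (Dual scl)) \<and>
     (\<forall>f\<in>carrier (Dual scl). \<forall>g\<in>carrier (Dual scl). F (\<lambda>x. f x + g x) = F f + F g) \<and>
     (\<forall>c. \<forall>f\<in>carrier (Dual scl). F (\<lambda>x. c * f x) = c * F f) \<and>
     (\<exists>M. \<forall>f\<in>carrier (Dual scl). norm (F f) \<le> M * nrm (Dual scl) f)"
  by (simp add: dual_def[of "Dual scl"] bounded_linear_map_def scalars_def space_of_def[of "(*)"]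
      del: Dual_ops(3))

lemma functional_act_in_Dual:
  assumes f: "f \<in> carrier (Dual scl)"
  shows "functional_act f \<phi> \<in> carrier (Dual scl)"
    and "norm (functional_act f \<phi> x) \<le> nrm (Dual scl) f * norm \<phi> * norm x"
proof -
  show bd: "norm (functional_act f \<phi> x) \<le> nrm (Dual scl) f * norm \<phi> * norm x" for x
    unfolding functional_act_def mult.assoc
    by (intro order_trans[OF Dual_norm_le[OF f]] mult_left_mono norm_mult_ineq Dual_norm_nonneg f)
  show "functional_act f \<phi> \<in> carrier (Dual scl)"
    by (rule carrier_DualI[OF _ _ bd])
      (simp_all add: functional_act_def distrib_left scale_mult_right Dual_add Dual_scl f)
qed

lemma act_functional_in_Dual:
  assumes f: "f \<in> carrier (Dual scl)"
  shows "act_functional \<phi> f \<in> carrier (Dual scl)"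
    and "norm (act_functional \<phi> f x) \<le> nrm (Dual scl) f * norm \<phi> * norm x"
proof -
  show bd: "norm (act_functional \<phi> f x) \<le> nrm (Dual scl) f * norm \<phi> * norm x" for x
    unfolding act_functional_def mult.assoc mult.commute[of "norm \<phi>"]
    by (intro order_trans[OF Dual_norm_le[OF f]] mult_left_mono norm_mult_ineq Dual_norm_nonneg f)
  show "act_functional \<phi> f \<in> carrier (Dual scl)"
    by (rule carrier_DualI[OF _ _ bd])
      (simp_all add: act_functional_def distrib_right scale_mult_left Dual_add Dual_scl f)
qed

section \<open>Limits along ultrafilters\<close>

text \<open>The Banach-Alaoglu theorem along an ultrafilter. It supplies the inner functionals of
  the Arens products and the limit in \<open>sample_range_closed\<close>.\<close>

lemma Dual_Lim:
  assumes U: "ultrafilter U"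
    and g: "eventually (\<lambda>\<xi>. g \<xi> \<in> carrier (Dual scl) \<and> (\<forall>x. norm (g \<xi> x) \<le> C * norm x)) U"
  shows "((\<lambda>\<xi>. g \<xi> x) \<longlongrightarrow> Lim U (\<lambda>\<xi>. g \<xi> x)) U"
    and "(\<lambda>x. Lim U (\<lambda>\<xi>. g \<xi> x)) \<in> carrier (Dual scl)"
proof -
  have nontriv: "\<not> trivial_limit U" using U by (simp add: ultrafilter_def)
  show lim: "((\<lambda>\<xi>. g \<xi> x) \<longlongrightarrow> Lim U (\<lambda>\<xi>. g \<xi> x)) U" for x
    by (rule ultrafilter_bounded_convergent[OF U, of _ "C * norm x"])
      (use g in \<open>auto elim: eventually_mono\<close>)
  show "(\<lambda>x. Lim U (\<lambda>\<xi>. g \<xi> x)) \<in> carrier (Dual scl)"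
  proof (rule carrier_DualI)
    fix x y
    have "((\<lambda>\<xi>. g \<xi> (x + y)) \<longlongrightarrow> Lim U (\<lambda>\<xi>. g \<xi> x) + Lim U (\<lambda>\<xi>. g \<xi> y)) U"
      by (rule Lim_transform_eventually[OF tendsto_add[OF lim[of x] lim[of y]]])
        (use g in \<open>auto simp: Dual_add elim: eventually_mono\<close>)
    then show "Lim U (\<lambda>\<xi>. g \<xi> (x + y)) = Lim U (\<lambda>\<xi>. g \<xi> x) + Lim U (\<lambda>\<xi>. g \<xi> y)"
      by (rule tendsto_Lim[OF nontriv])
  next
    fix c x
    have "((\<lambda>\<xi>. g \<xi> (scl c x)) \<longlongrightarrow> c * Lim U (\<lambda>\<xi>. g \<xi> x)) U"
      by (rule Lim_transform_eventually[OF tendsto_mult[OF tendsto_const lim[of x]]])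
        (use g in \<open>auto simp: Dual_scl elim: eventually_mono\<close>)
    then show "Lim U (\<lambda>\<xi>. g \<xi> (scl c x)) = c * Lim U (\<lambda>\<xi>. g \<xi> x)"
      by (rule tendsto_Lim[OF nontriv])
  next
    fix x
    show "norm (Lim U (\<lambda>\<xi>. g \<xi> x)) \<le> C * norm x"
      by (rule tendsto_upperbound[OF tendsto_norm[OF lim[of x]] _ nontriv])
        (use g in \<open>auto elim: eventually_mono\<close>)
  qed
qed

text \<open>The weak* limit in the bidual of the evaluations at \<open>b \<xi>\<close>. The
  restriction makes it extensional, as members of the bidual must be.\<close>

definition limit_functional :: "'l filter \<Rightarrow> ('l \<Rightarrow> 'a) \<Rightarrow> ('a \<Rightarrow> 'k) \<Rightarrow> 'k" where
  "limit_functional U b = (\<lambda>f\<in>carrier (Dual scl). Lim U (\<lambda>\<xi>. f (b \<xi>)))"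

lemma limit_functional_tendsto:
  assumes U: "ultrafilter U" and b: "eventually (\<lambda>\<xi>. norm (b \<xi>) \<le> M) U"
    and f: "f \<in> carrier (Dual scl)"
  shows "((\<lambda>\<xi>. f (b \<xi>)) \<longlongrightarrow> limit_functional U b f) U"
    and "norm (limit_functional U b f) \<le> M * nrm (Dual scl) f"
proof -
  have bd: "eventually (\<lambda>\<xi>. norm (f (b \<xi>)) \<le> M * nrm (Dual scl) f) U"
    using b
  proof eventually_elim
    case (elim \<xi>)
    have "norm (f (b \<xi>)) \<le> nrm (Dual scl) f * norm (b \<xi>)" by (rule Dual_norm_le[OF f])
    also have "\<dots> \<le> nrm (Dual scl) f * M"
      by (intro mult_left_mono elim Dual_norm_nonneg f)
    finally show ?case by (simp add: mult.commute)
  qed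
  show lim: "((\<lambda>\<xi>. f (b \<xi>)) \<longlongrightarrow> limit_functional U b f) U"
    using ultrafilter_bounded_convergent[OF U bd] f by (simp add: limit_functional_def)
  show "norm (limit_functional U b f) \<le> M * nrm (Dual scl) f"
    by (rule tendsto_upperbound[OF tendsto_norm[OF lim] bd]) (use U in \<open>simp add: ultrafilter_def\<close>)
qed

lemma limit_functional_eqI:
  assumes "ultrafilter U" "f \<in> carrier (Dual scl)" "((\<lambda>\<xi>. f (b \<xi>)) \<longlongrightarrow> l) U"
  shows "limit_functional U b f = l"
  using assms by (simp add: limit_functional_def tendsto_Lim ultrafilter_def)

lemma limit_functional_in_Bidual:
  assumes U: "ultrafilter U" and b: "eventually (\<lambda>\<xi>. norm (b \<xi>) \<le> M) U"
  shows "limit_functional U b \<in> carrier (Bidual scl)"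
  unfolding carrier_Bidual_iff
proof (intro conjI ballI allI exI)
  show "limit_functional U b \<in> extensional (carrier (Dual scl))"
    by (simp add: limit_functional_def)
next
  fix f g assume fg: "f \<in> carrier (Dual scl)" "g \<in> carrier (Dual scl)"
  show "limit_functional U b (\<lambda>x. f x + g x) = limit_functional U b f + limit_functional U b g"
    by (rule limit_functional_eqI[OF U Dual_closed(1)[OF fg]])
      (intro tendsto_add limit_functional_tendsto[OF U b] fg)
next
  fix c f assume f: "f \<in> carrier (Dual scl)"
  show "limit_functional U b (\<lambda>x. c * f x) = c * limit_functional U b f"
    by (rule limit_functional_eqI[OF U Dual_closed(2)[OF f]])
      (intro tendsto_mult tendsto_const limit_functional_tendsto[OF U b] f)
next
  fix f assume "f \<in> carrier (Dual scl)"
  then show "norm (limit_functional U b f) \<le> M * nrm (Dual scl) f"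
    by (rule limit_functional_tendsto[OF U b])
qed

lemma evaluation_in_Bidual: "(\<lambda>f\<in>carrier (Dual scl). f v) \<in> carrier (Bidual scl)"
  unfolding carrier_Bidual_iff
proof (intro conjI ballI allI exI)
  fix f assume f: "f \<in> carrier (Dual scl)"
  show "norm ((\<lambda>f\<in>carrier (Dual scl). f v) f) \<le> norm v * nrm (Dual scl) f"
    using Dual_norm_le[OF f, of v] f by (simp add: mult.commute)
qed (auto simp: Dual_closed)

end

section \<open>Weak topologies\<close>

lemma topspace_weak_topology_subset: "topspace (weak_topology X) \<subseteq> carrier X"
  by (auto simp: weak_topology_def)

lemma openin_weak_topology:
  assumes "F \<in> carrier (dual X)" "open V"
  shows "openin (weak_topology X) {x \<in> carrier X. F x \<in> V}"
  unfolding weak_topology_def by (rule topology_generated_by_Basis) (use assms in blast)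

lemma continuous_map_weak_topology_functional:
  fixes X :: "('k::real_or_complex, 'v) normed_space"
  assumes F: "F \<in> carrier (dual X)"
  shows "continuous_map (weak_topology X) euclidean F"
  unfolding continuous_map_def
proof (intro conjI allI impI)
  fix V :: "'k set" assume "openin euclidean V"
  then have "openin (weak_topology X) (topspace (weak_topology X) \<inter> {x \<in> carrier X. F x \<in> V})"
    using openin_weak_topology[OF F] by (intro openin_Int) auto
  also have "topspace (weak_topology X) \<inter> {x \<in> carrier X. F x \<in> V} =
      {x \<in> topspace (weak_topology X). F x \<in> V}"
    using topspace_weak_topology_subset[of X] by blast
  finally show "openin (weak_topology X) {x \<in> topspace (weak_topology X). F x \<in> V}" .
qed simp

lemma continuous_map_into_weak_topology:
  assumes "h \<in> topspace Z \<rightarrow> topspace (weak_topology X)"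
    and "\<And>F. F \<in> carrier (dual X) \<Longrightarrow> continuous_map Z euclidean (\<lambda>z. F (h z))"
  shows "continuous_map Z (weak_topology X) h"
  unfolding weak_topology_def
proof (rule continuous_on_generated_topo)
  fix W assume "W \<in> {{x \<in> carrier X. F x \<in> V} |F V. F \<in> carrier (dual X) \<and> open V}"
  then obtain F V where W: "W = {x \<in> carrier X. F x \<in> V}" "F \<in> carrier (dual X)" "open V" by auto
  have "h -` W \<inter> topspace Z = {z \<in> topspace Z. F (h z) \<in> V}"
    using assms(1) topspace_weak_topology_subset[of X] by (auto simp: W(1))
  then show "openin Z (h -` W \<inter> topspace Z)"
    using openin_continuous_map_preimage[OF assms(2)[OF W(2)], of V] W(3) by simp
next
  show "h ` topspace Z \<subseteq> \<Union> {{x \<in> carrier X. F x \<in> V} |F V. F \<in> carrier (dual X) \<and> open V}"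
    using assms(1) by (auto simp: weak_topology_def)
qed

lemma limitin_weak_topology_functional:
  assumes "limitin (weak_topology X) h g U" and F: "F \<in> carrier (dual X)"
  shows "((\<lambda>\<xi>. F (h \<xi>)) \<longlongrightarrow> F g) U"
proof -
  have "limitin euclidean (F \<circ> h) (F g) U"
    by (rule continuous_map_limit[OF continuous_map_weak_topology_functional[OF F] assms(1)])
  then show ?thesis by (simp add: comp_def)
qed

section \<open>Weakly almost periodic functionals\<close>

context banach_algebra
begin

lemma topspace_weak_topology_Dual: "topspace (weak_topology (Dual scl)) = carrier (Dual scl)"
proof -
  have "openin (weak_topology (Dual scl))
      {f \<in> carrier (Dual scl). (\<lambda>f\<in>carrier (Dual scl). f 0) f \<in> UNIV}"
    by (rule openin_weak_topology[OF evaluation_in_Bidual open_UNIV])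
  from openin_subset[OF this] have "carrier (Dual scl) \<subseteq> topspace (weak_topology (Dual scl))"
    by simp
  with topspace_weak_topology_subset show ?thesis by (rule subset_antisym)
qed

lemma Hausdorff_weak_topology_Dual: "Hausdorff_space (weak_topology (Dual scl))"
  unfolding Hausdorff_space_def topspace_weak_topology_Dual
proof (intro allI impI)
  fix f g assume fg: "f \<in> carrier (Dual scl) \<and> g \<in> carrier (Dual scl) \<and> f \<noteq> g"
  then obtain v where "f v \<noteq> g v" by auto
  then obtain S T where ST: "open S" "open T" "f v \<in> S" "g v \<in> T" "S \<inter> T = {}"
    by (metis hausdorff)
  let ?E = "\<lambda>V. {f \<in> carrier (Dual scl). (\<lambda>f\<in>carrier (Dual scl). f v) f \<in> V}"
  have "openin (weak_topology (Dual scl)) (?E S)" "openin (weak_topology (Dual scl)) (?E T)"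
    by (rule openin_weak_topology[OF evaluation_in_Bidual], use ST in simp)+
  moreover have "f \<in> ?E S" "g \<in> ?E T" "disjnt (?E S) (?E T)"
    using ST fg by (auto simp: disjnt_def)
  ultimately show "\<exists>U V. openin (weak_topology (Dual scl)) U \<and> openin (weak_topology (Dual scl)) V \<and>
      f \<in> U \<and> g \<in> V \<and> disjnt U V"
    by blast
qed

text \<open>Point evaluations make the weak topology Hausdorff, so \<open>K\<close> is closed and
  contains the closure of \<open>S\<close>. Membership in \<open>WAP\<close> can thus be verified
  with any compact set around the orbit.\<close>

lemma relatively_weakly_compact_Dual_subset:
  assumes K: "compactin (weak_topology (Dual scl)) K" and "S \<subseteq> K"
  shows "relatively_weakly_compact (Dual scl) S"
  unfolding relatively_weakly_compact_def
proof
  show "S \<subseteq> carrier (Dual scl)"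
    using compactin_subset_topspace[OF K] assms(2) by (simp add: topspace_weak_topology_Dual)
  have "closedin (weak_topology (Dual scl)) K"
    by (rule compactin_imp_closedin[OF Hausdorff_weak_topology_Dual K])
  then have "weak_topology (Dual scl) closure_of S \<subseteq> K"
    using assms(2) by (rule closure_of_minimal[rotated])
  then show "compactin (weak_topology (Dual scl)) (weak_topology (Dual scl) closure_of S)"
    by (rule closed_compactin[OF K _ closedin_closure_of])
qed

lemma WAP_subset_Dual: "WAP scl \<subseteq> carrier (Dual scl)"
  by (auto simp: WAP_def)

lemma WAP_orbit_compact:
  assumes "f \<in> WAP scl"
  shows "\<exists>K. compactin (weak_topology (Dual scl)) K \<and> K \<subseteq> carrier (Dual scl) \<and>
    (\<forall>\<phi>. norm \<phi> \<le> 1 \<longrightarrow> functional_act f \<phi> \<in> K)"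
proof -
  let ?S = "{functional_act f \<phi> | \<phi>. norm \<phi> \<le> 1}"
  have K: "compactin (weak_topology (Dual scl)) (weak_topology (Dual scl) closure_of ?S)"
    and "?S \<subseteq> topspace (weak_topology (Dual scl))"
    using assms by (auto simp: WAP_def relatively_weakly_compact_def topspace_weak_topology_Dual)
  then have "?S \<subseteq> weak_topology (Dual scl) closure_of ?S" by (intro closure_of_subset)
  with K compactin_subset_topspace[OF K] topspace_weak_topology_Dual show ?thesis by blast
qed

lemma WAP_I:
  assumes "f \<in> carrier (Dual scl)" "compactin (weak_topology (Dual scl)) K"
    and "\<And>\<phi>. norm \<phi> \<le> 1 \<Longrightarrow> functional_act f \<phi> \<in> K"
  shows "f \<in> WAP scl"
proof -
  have "relatively_weakly_compact (Dual scl) {functional_act f \<phi> | \<phi>. norm \<phi> \<le> 1}"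
    using assms(3) by (intro relatively_weakly_compact_Dual_subset[OF assms(2)]) blast
  with assms(1) show ?thesis by (simp add: WAP_def)
qed

lemma zero_in_WAP: "(\<lambda>x. 0) \<in> WAP scl"
proof (rule WAP_I[OF zero_in_Dual])
  show "compactin (weak_topology (Dual scl)) {\<lambda>x. 0}"
    by (rule finite_imp_compactin) (auto simp: topspace_weak_topology_Dual zero_in_Dual)
qed (simp add: functional_act_def)

lemma WAP_scale:
  assumes f: "f \<in> WAP scl"
  shows "(\<lambda>x. c * f x) \<in> WAP scl"
proof -
  from WAP_orbit_compact[OF f] obtain K where K: "compactin (weak_topology (Dual scl)) K"
      "K \<subseteq> carrier (Dual scl)" "\<And>\<phi>. norm \<phi> \<le> 1 \<Longrightarrow> functional_act f \<phi> \<in> K" by blast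
  have "continuous_map (weak_topology (Dual scl)) (weak_topology (Dual scl)) (\<lambda>g x. c * g x)"
  proof (rule continuous_map_into_weak_topology)
    show "(\<lambda>g x. c * g x) \<in> topspace (weak_topology (Dual scl)) \<rightarrow> topspace (weak_topology (Dual scl))"
      by (auto simp: topspace_weak_topology_Dual Dual_closed)
  next
    fix F assume F: "F \<in> carrier (Bidual scl)"
    have "continuous_map (weak_topology (Dual scl)) euclidean ((\<lambda>z. c * z) \<circ> F)"
      by (rule continuous_map_compose[OF continuous_map_weak_topology_functional[OF F]])
        (simp add: continuous_intros)
    then show "continuous_map (weak_topology (Dual scl)) euclidean (\<lambda>g. F (\<lambda>x. c * g x))"
      by (rule continuous_map_eq)
        (use F in \<open>auto simp: carrier_Bidual_iff topspace_weak_topology_Dual\<close>)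
  qed
  note image = image_compactin[OF K(1) this]
  show ?thesis
  proof (rule WAP_I[OF _ image])
    show "(\<lambda>x. c * f x) \<in> carrier (Dual scl)" using f WAP_subset_Dual by (blast intro: Dual_closed)
  next
    fix \<phi> :: 'a assume "norm \<phi> \<le> 1"
    then show "functional_act (\<lambda>x. c * f x) \<phi> \<in> (\<lambda>g x. c * g x) ` K"
      by (intro image_eqI[OF _ K(3)]) (auto simp: functional_act_def)
  qed
qed

text \<open>The orbit of the sum lies in \<open>K + L\<close>, the image of the compact set
  \<open>K \<times> L\<close> under addition, which is weakly continuous because each bidual
  functional is additive.\<close>

lemma WAP_add:
  assumes f: "f \<in> WAP scl" and g: "g \<in> WAP scl"
  shows "(\<lambda>x. f x + g x) \<in> WAP scl"
proof -
  let ?w = "weak_topology (Dual scl)"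
  from WAP_orbit_compact[OF f] obtain K where K: "compactin ?w K"
      "K \<subseteq> carrier (Dual scl)" "\<And>\<phi>. norm \<phi> \<le> 1 \<Longrightarrow> functional_act f \<phi> \<in> K" by blast
  from WAP_orbit_compact[OF g] obtain L where L: "compactin ?w L"
      "L \<subseteq> carrier (Dual scl)" "\<And>\<phi>. norm \<phi> \<le> 1 \<Longrightarrow> functional_act g \<phi> \<in> L" by blast
  have KL: "compactin (prod_topology ?w ?w) (K \<times> L)"
    using K L by (simp add: compactin_Times)
  have "continuous_map (prod_topology ?w ?w) ?w (\<lambda>p x. fst p x + snd p x)"
  proof (rule continuous_map_into_weak_topology)
    show "(\<lambda>p x. fst p x + snd p x) \<in> topspace (prod_topology ?w ?w) \<rightarrow> topspace ?w"
      by (auto simp: topspace_weak_topology_Dual Dual_closed)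
  next
    fix F assume F: "F \<in> carrier (Bidual scl)"
    have "continuous_map (prod_topology ?w ?w) euclidean (F \<circ> fst)"
      "continuous_map (prod_topology ?w ?w) euclidean (F \<circ> snd)"
      by (rule continuous_map_compose[OF _ continuous_map_weak_topology_functional[OF F]],
          simp add: continuous_map_fst continuous_map_snd)+
    then have "continuous_map (prod_topology ?w ?w) euclidean (\<lambda>p. F (fst p) + F (snd p))"
      unfolding comp_def by (rule continuous_map_add)
    then show "continuous_map (prod_topology ?w ?w) euclidean (\<lambda>p. F (\<lambda>x. fst p x + snd p x))"
      by (rule continuous_map_eq)
        (use F in \<open>auto simp: carrier_Bidual_iff topspace_weak_topology_Dual\<close>)
  qed
  note image = image_compactin[OF KL this]
  show ?thesis
  proof (rule WAP_I[OF _ image])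
    show "(\<lambda>x. f x + g x) \<in> carrier (Dual scl)"
      using f g WAP_subset_Dual by (blast intro: Dual_closed)
  next
    fix \<phi> :: 'a assume \<phi>: "norm \<phi> \<le> 1"
    show "functional_act (\<lambda>x. f x + g x) \<phi> \<in> (\<lambda>p x. fst p x + snd p x) ` (K \<times> L)"
      using K(3)[OF \<phi>] L(3)[OF \<phi>] by (intro image_eqI[of _ _ "(functional_act f \<phi>, functional_act g \<phi>)"])
        (auto simp: functional_act_def)
  qed
qed

text \<open>The ultrafilter converges inside the weakly compact set around the orbit. The point is
  that one \<open>g\<close> serves every bidual functional: it can be tested both with evaluations
  and with limits along another net.\<close>

lemma WAP_weak_limit:
  assumes U: "ultrafilter U" and f: "f \<in> WAP scl" and b: "eventually (\<lambda>\<xi>. norm (b \<xi>) \<le> M) U"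
  shows "\<exists>g\<in>carrier (Dual scl). \<forall>F\<in>carrier (Bidual scl).
    ((\<lambda>\<xi>. F (functional_act f (b \<xi>))) \<longlongrightarrow> F g) U"
proof -
  \<comment> \<open>Compactness is known for the orbit of the unit ball only, so the net is divided
    by \<open>N\<close> and the limit multiplied by it; the maximum with 1 keeps \<open>N\<close>
    positive.\<close>
  define N where "N = max M 1"
  have N: "0 < N" "M \<le> N" by (auto simp: N_def)
  have fD: "f \<in> carrier (Dual scl)" using f WAP_subset_Dual by blast
  from WAP_orbit_compact[OF f] obtain K where K: "compactin (weak_topology (Dual scl)) K"
      "K \<subseteq> carrier (Dual scl)" "\<And>\<phi>. norm \<phi> \<le> 1 \<Longrightarrow> functional_act f \<phi> \<in> K" by blast
  let ?h = "\<lambda>\<xi>. functional_act f ((1 / N) *\<^sub>R b \<xi>)"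
  have "eventually (\<lambda>\<xi>. ?h \<xi> \<in> K) U"
    using b
  proof eventually_elim
    case (elim \<xi>)
    then show ?case using N by (intro K(3)) (simp add: field_simps)
  qed
  from ultrafilter_limitin_compactin[OF U K(1) this] obtain g
    where g: "g \<in> K" "limitin (weak_topology (Dual scl)) ?h g U" by blast
  have gD: "g \<in> carrier (Dual scl)" using g K by blast
  show ?thesis
  proof (intro bexI ballI)
    show "(\<lambda>x. of_real N * g x) \<in> carrier (Dual scl)" by (rule Dual_closed(2)[OF gD])
  next
    fix F assume F: "F \<in> carrier (Bidual scl)"
    have Fs: "F (\<lambda>x. c * h x) = c * F h" if "h \<in> carrier (Dual scl)" for c h
      using F that by (auto simp: carrier_Bidual_iff)
    have "functional_act f (b \<xi>) = (\<lambda>x. of_real N * ?h \<xi> x)" for \<xi>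
      using N by (simp add: functional_act_def Dual_scaleR[OF fD])
    then have *: "F (functional_act f (b \<xi>)) = of_real N * F (?h \<xi>)" for \<xi>
      by (simp only: Fs[OF functional_act_in_Dual(1)[OF fD]])
    show "((\<lambda>\<xi>. F (functional_act f (b \<xi>))) \<longlongrightarrow> F (\<lambda>x. of_real N * g x)) U"
      unfolding * Fs[OF gD]
      by (intro tendsto_mult tendsto_const limitin_weak_topology_functional[OF g(2) F])
  qed
qed

end

section \<open>Two nets absorbing one another\<close>

text \<open>What remains of two subnets once the order is forgotten. The outer index is only
  eventually good along \<open>U\<close>, which suffices for an outer limit along the same
  \<open>U\<close>.\<close>

locale absorbing_nets = banach_algebra scl
  for scl :: "'k::real_or_complex \<Rightarrow> 'a::{real_normed_algebra,banach} \<Rightarrow> 'a" +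
  fixes U :: "'l filter" and b c :: "'l \<Rightarrow> 'a" and M :: real
  assumes U: "ultrafilter U"
    and b_bounded: "eventually (\<lambda>\<xi>. norm (b \<xi>) \<le> M) U"
    and c_bounded: "eventually (\<lambda>\<xi>. norm (c \<xi>) \<le> M) U"
    and absorb_left: "eventually (\<lambda>\<zeta>. ((\<lambda>\<xi>. b \<zeta> * c \<xi> - c \<xi>) \<longlongrightarrow> 0) U) U"
    and absorb_right: "eventually (\<lambda>\<zeta>. ((\<lambda>\<xi>. b \<xi> * c \<zeta> - b \<xi>) \<longlongrightarrow> 0) U) U"
begin

lemma nontrivial: "\<not> trivial_limit U"
  using U by (simp add: ultrafilter_def)

lemma Dual_tendsto_zero:
  assumes "f \<in> carrier (Dual scl)" "(h \<longlongrightarrow> 0) U"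
  shows "((\<lambda>\<xi>. f (h \<xi>)) \<longlongrightarrow> 0) U"
proof (rule Lim_null_comparison)
  show "eventually (\<lambda>\<xi>. norm (f (h \<xi>)) \<le> nrm (Dual scl) f * norm (h \<xi>)) U"
    using Dual_norm_le[OF assms(1)] by simp
  show "((\<lambda>\<xi>. nrm (Dual scl) f * norm (h \<xi>)) \<longlongrightarrow> 0) U"
    using assms(2) by (intro tendsto_mult_right_zero tendsto_norm_zero)
qed

lemma left_limit:
  assumes f: "f \<in> carrier (Dual scl)"
  shows "eventually (\<lambda>\<zeta>. ((\<lambda>\<xi>. f (b \<zeta> * c \<xi>)) \<longlongrightarrow> limit_functional U c f) U) U"
  using absorb_left
proof eventually_elim
  case (elim \<zeta>)
  have "((\<lambda>\<xi>. f (c \<xi>) + f (b \<zeta> * c \<xi> - c \<xi>)) \<longlongrightarrow> limit_functional U c f + 0) U"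
    by (intro tendsto_add limit_functional_tendsto(1)[OF U c_bounded f] Dual_tendsto_zero f elim)
  then show ?case by (simp add: Dual_diff f)
qed

lemma right_limit:
  assumes f: "f \<in> carrier (Dual scl)"
  shows "eventually (\<lambda>\<zeta>. ((\<lambda>\<xi>. f (b \<xi> * c \<zeta>)) \<longlongrightarrow> limit_functional U b f) U) U"
  using absorb_right
proof eventually_elim
  case (elim \<zeta>)
  have "((\<lambda>\<xi>. f (b \<xi>) + f (b \<xi> * c \<zeta> - b \<xi>)) \<longlongrightarrow> limit_functional U b f + 0) U"
    by (intro tendsto_add limit_functional_tendsto(1)[OF U b_bounded f] Dual_tendsto_zero f elim)
  then show ?case by (simp add: Dual_diff f)
qed

text \<open>The iterated limits of \<open>f (b \<zeta> * c \<xi>)\<close> are the limits of \<open>f \<circ> c\<close> and of \<open>f \<circ> b\<close>, and weak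
  compactness of the orbit makes the iterated limits agree.\<close>

lemma WAP_limits_eq:
  assumes f: "f \<in> WAP scl"
  shows "limit_functional U b f = limit_functional U c f"
proof -
  have fD: "f \<in> carrier (Dual scl)" using f WAP_subset_Dual by blast
  from WAP_weak_limit[OF U f b_bounded] obtain g where g: "g \<in> carrier (Dual scl)"
    and lim: "\<And>F. F \<in> carrier (Bidual scl) \<Longrightarrow>
      ((\<lambda>\<xi>. F (functional_act f (b \<xi>))) \<longlongrightarrow> F g) U" by blast
  have act: "functional_act f \<phi> \<in> carrier (Dual scl)" for \<phi>
    by (rule functional_act_in_Dual[OF fD])
  \<comment> \<open>Testing the weak limit \<open>g\<close> with the evaluation at
    \<open>c \<zeta>\<close> shows that \<open>g\<close> is eventually constant along
    \<open>c\<close>, with value the limit of \<open>f\<close> along \<open>b\<close>.\<close>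
  have "eventually (\<lambda>\<zeta>. g (c \<zeta>) = limit_functional U b f) U"
    using right_limit[OF fD]
  proof eventually_elim
    case (elim \<zeta>)
    have "((\<lambda>\<xi>. f (b \<xi> * c \<zeta>)) \<longlongrightarrow> g (c \<zeta>)) U"
      using lim[OF evaluation_in_Bidual[of "c \<zeta>"]] g act by (simp add: functional_act_def)
    with elim show ?case by (intro tendsto_unique[OF nontrivial])
  qed
  then have 1: "limit_functional U c g = limit_functional U b f"
    by (intro limit_functional_eqI[OF U g] tendsto_eventually)
  \<comment> \<open>Testing \<open>g\<close> with the limit along \<open>c\<close> itself, again a
    bidual functional, produces the limit of \<open>f\<close> along \<open>c\<close>
    instead.\<close>
  have "eventually (\<lambda>\<zeta>. limit_functional U c (functional_act f (b \<zeta>)) = limit_functional U c f) U"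
    using left_limit[OF fD]
    by eventually_elim (rule limit_functional_eqI[OF U act], simp add: functional_act_def)
  then have "((\<lambda>\<zeta>. limit_functional U c (functional_act f (b \<zeta>))) \<longlongrightarrow> limit_functional U c f) U"
    by (rule tendsto_eventually)
  with lim[OF limit_functional_in_Bidual[OF U c_bounded]]
  have "limit_functional U c g = limit_functional U c f"
    by (intro tendsto_unique[OF nontrivial])
  with 1 show ?thesis by simp
qed

text \<open>The inner functional takes at \<open>b \<zeta>\<close> the value
  \<open>lim f (b \<zeta> * c \<xi>)\<close> over \<open>\<xi>\<close>, which is eventually the
  limit of \<open>f\<close> along \<open>c\<close>; the outer limit is then that of a
  constant.\<close>

lemma arens1_limits:
  assumes f: "f \<in> carrier (Dual scl)"
  shows "arens1 scl (limit_functional U b) (limit_functional U c) f = limit_functional U c f"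
proof -
  let ?h = "\<lambda>\<phi>. limit_functional U c (functional_act f \<phi>)"
  \<comment> \<open>Moving \<open>c \<xi>\<close> to the other side exhibits the inner functional as
    a pointwise limit of bounded functionals, so that \<open>Dual_Lim\<close> puts it into the dual,
    where the outer \<open>limit_functional\<close> is defined.\<close>
  have h: "?h = (\<lambda>\<phi>. Lim U (\<lambda>\<xi>. act_functional (c \<xi>) f \<phi>))"
    using functional_act_in_Dual(1)[OF f]
    by (auto simp: limit_functional_def functional_act_def act_functional_def)
  have "eventually (\<lambda>\<xi>. act_functional (c \<xi>) f \<in> carrier (Dual scl) \<and>
      (\<forall>x. norm (act_functional (c \<xi>) f x) \<le> nrm (Dual scl) f * M * norm x)) U"
    using c_bounded
    by eventually_elim (auto intro!: act_functional_in_Dual f mult_right_mono mult_left_mono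
        Dual_norm_nonneg order_trans[OF act_functional_in_Dual(2)[OF f]])
  from Dual_Lim(2)[OF U this] have hD: "?h \<in> carrier (Dual scl)" unfolding h .
  have "eventually (\<lambda>\<zeta>. ?h (b \<zeta>) = limit_functional U c f) U"
    using left_limit[OF f]
    by eventually_elim
      (rule limit_functional_eqI[OF U functional_act_in_Dual(1)[OF f]], simp add: functional_act_def)
  then have "limit_functional U b ?h = limit_functional U c f"
    by (intro limit_functional_eqI[OF U hD] tendsto_eventually)
  then show ?thesis using f by (simp add: arens1_def)
qed

lemma arens2_limits:
  assumes f: "f \<in> carrier (Dual scl)"
  shows "arens2 scl (limit_functional U b) (limit_functional U c) f = limit_functional U b f"
proof -
  let ?h = "\<lambda>\<phi>. limit_functional U b (act_functional \<phi> f)"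
  have h: "?h = (\<lambda>\<phi>. Lim U (\<lambda>\<xi>. functional_act f (b \<xi>) \<phi>))"
    using act_functional_in_Dual(1)[OF f]
    by (auto simp: limit_functional_def functional_act_def act_functional_def)
  have "eventually (\<lambda>\<xi>. functional_act f (b \<xi>) \<in> carrier (Dual scl) \<and>
      (\<forall>x. norm (functional_act f (b \<xi>) x) \<le> nrm (Dual scl) f * M * norm x)) U"
    using b_bounded
    by eventually_elim (auto intro!: functional_act_in_Dual f mult_right_mono mult_left_mono
        Dual_norm_nonneg order_trans[OF functional_act_in_Dual(2)[OF f]])
  from Dual_Lim(2)[OF U this] have hD: "?h \<in> carrier (Dual scl)" unfolding h .
  have "eventually (\<lambda>\<zeta>. ?h (c \<zeta>) = limit_functional U b f) U"
    using right_limit[OF f]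
    by eventually_elim
      (rule limit_functional_eqI[OF U act_functional_in_Dual(1)[OF f]], simp add: act_functional_def)
  then have "limit_functional U c ?h = limit_functional U b f"
    by (intro limit_functional_eqI[OF U hD] tendsto_eventually)
  then show ?thesis using f by (simp add: arens2_def)
qed

lemma not_arens_regular:
  assumes "f \<in> carrier (Dual scl)" "limit_functional U b f \<noteq> limit_functional U c f"
  shows "\<not> arens_regular scl"
proof
  assume "arens_regular scl"
  then have "arens1 scl (limit_functional U b) (limit_functional U c) =
      arens2 scl (limit_functional U b) (limit_functional U c)"
    using limit_functional_in_Bidual[OF U b_bounded] limit_functional_in_Bidual[OF U c_bounded]
    by (simp add: arens_regular_def)
  from fun_cong[OF this, of f] show False
    using assms by (simp add: arens1_limits arens2_limits)
qed

end

section \<open>Extension of functionals\<close>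

lemma imaginary_unit_coordinates_unique:
  fixes i :: "'k::real_normed_field"
  assumes i: "i * i = - 1" and eq: "r *\<^sub>R 1 + s *\<^sub>R i = r' *\<^sub>R 1 + s' *\<^sub>R i"
  shows "r = r'" "s = s'"
proof -
  have "(r - r') *\<^sub>R 1 + (s - s') *\<^sub>R i = 0"
    using eq by (simp add: algebra_simps)
  with imaginary_unit_coordinates_le[OF i, of "r - r'" "s - s'"]
  have "\<bar>r - r'\<bar> + \<bar>s - s'\<bar> \<le> 0" by simp
  then show "r = r'" "s = s'" by linarith+
qed

context banach_algebra
begin

text \<open>\<open>\<rho>\<close> is the real part; over the complex numbers \<open>F x = f x - i f (i x)\<close>.\<close>

lemma real_part_exists:
  "\<exists>\<rho> :: 'k \<Rightarrow> real. linear \<rho> \<and> (\<forall>z. \<bar>\<rho> z\<bar> \<le> 2 * norm z) \<and> \<rho> 1 = 1 \<and>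
     (\<forall>f K. linear f \<longrightarrow> (\<forall>x. \<bar>f x\<bar> \<le> K * norm x) \<longrightarrow>
        (\<exists>F\<in>carrier (Dual scl). \<forall>x. \<rho> (F x) = f x))"
  using real_or_complex
proof
  assume "\<forall>x :: 'k. \<exists>r. x = r *\<^sub>R 1"
  then obtain \<rho> :: "'k \<Rightarrow> real" where \<rho>: "\<And>z. z = \<rho> z *\<^sub>R 1" by metis
  have \<rho>_eq: "\<rho> (r *\<^sub>R 1) = r" for r
    using \<rho>[of "r *\<^sub>R 1"] by simp
  show ?thesis
  proof (intro exI[of _ \<rho>] conjI allI impI)
    show "linear \<rho>"
    proof (rule linearI)
      show "\<rho> (z + w) = \<rho> z + \<rho> w" for z w
        by (metis \<rho> \<rho>_eq scaleR_left_distrib)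
      show "\<rho> (r *\<^sub>R z) = r *\<^sub>R \<rho> z" for r z
        by (metis \<rho> \<rho>_eq scaleR_scaleR real_scaleR_def)
    qed
    show "\<bar>\<rho> z\<bar> \<le> 2 * norm z" for z
    proof -
      have "norm z = \<bar>\<rho> z\<bar>" by (subst \<rho>) simp
      then show ?thesis by simp
    qed
    show "\<rho> 1 = 1" using \<rho>_eq[of 1] by simp
  next
    fix f :: "'a \<Rightarrow> real" and K assume f: "linear f" "\<forall>x. \<bar>f x\<bar> \<le> K * norm x"
    have "(\<lambda>x. f x *\<^sub>R 1) \<in> carrier (Dual scl)"
    proof (rule carrier_DualI)
      show "f (x + y) *\<^sub>R (1 :: 'k) = f x *\<^sub>R 1 + f y *\<^sub>R 1" for x y
        using f(1) by (simp add: linear_add scaleR_left_distrib)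
      show "f (scl c x) *\<^sub>R 1 = c * f x *\<^sub>R 1" for c x
      proof -
        have "scl c x = \<rho> c *\<^sub>R x" using scl_scaleR_left[of "\<rho> c" 1 x] \<rho>[of c] by simp
        then have "f (scl c x) *\<^sub>R 1 = f x *\<^sub>R \<rho> c *\<^sub>R (1 :: 'k)"
          using f(1) by (simp add: linear_scale)
        then show ?thesis using \<rho>[of c] by simp
      qed
      show "norm (f x *\<^sub>R (1 :: 'k)) \<le> K * norm x" for x using f(2) by simp
    qed
    then show "\<exists>F\<in>carrier (Dual scl). \<forall>x. \<rho> (F x) = f x"
      using \<rho>_eq by (intro bexI) auto
  qed
next
  assume "\<exists>i :: 'k. i * i = - 1 \<and> (\<forall>x. \<exists>r s. x = r *\<^sub>R 1 + s *\<^sub>R i)"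
  then obtain i :: 'k where i: "i * i = - 1" and "\<And>x. \<exists>r s. x = r *\<^sub>R 1 + s *\<^sub>R i" by blast
  then obtain \<rho> \<sigma> :: "'k \<Rightarrow> real" where \<rho>: "\<And>z. z = \<rho> z *\<^sub>R 1 + \<sigma> z *\<^sub>R i" by metis
  have \<rho>_eq: "\<rho> (r *\<^sub>R 1 + s *\<^sub>R i) = r" for r s
    using imaginary_unit_coordinates_unique(1)[OF i \<rho>[of "r *\<^sub>R 1 + s *\<^sub>R i"]] by simp
  show ?thesis
  proof (intro exI[of _ \<rho>] conjI allI impI)
    show "linear \<rho>"
    proof (rule linearI)
      fix z w :: 'k
      have "z + w = (\<rho> z + \<rho> w) *\<^sub>R 1 + (\<sigma> z + \<sigma> w) *\<^sub>R i"
        by (subst \<rho>[of z], subst \<rho>[of w]) (simp add: algebra_simps)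
      then show "\<rho> (z + w) = \<rho> z + \<rho> w" using \<rho>_eq by metis
    next
      fix r and z :: 'k
      have "r *\<^sub>R z = (r * \<rho> z) *\<^sub>R 1 + (r * \<sigma> z) *\<^sub>R i"
        by (subst \<rho>[of z]) (simp add: scaleR_right_distrib)
      then show "\<rho> (r *\<^sub>R z) = r *\<^sub>R \<rho> z" using \<rho>_eq by (metis real_scaleR_def)
    qed
    show "\<bar>\<rho> z\<bar> \<le> 2 * norm z" for z
      using imaginary_unit_coordinates_le[OF i, of "\<rho> z" "\<sigma> z"] \<rho>[of z] by simp
    show "\<rho> 1 = 1" using \<rho>_eq[of 1 0] by simp
  next
    fix f :: "'a \<Rightarrow> real" and K assume f: "linear f" "\<forall>x. \<bar>f x\<bar> \<le> K * norm x"
    let ?F = "\<lambda>x. f x *\<^sub>R 1 + (- f (scl i x)) *\<^sub>R i"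
    have "?F \<in> carrier (Dual scl)"
    proof (rule carrier_DualI)
      show "?F (x + y) = ?F x + ?F y" for x y
        using f(1) by (simp add: linear_add scale_right_distrib algebra_simps)
    next
      fix c x
      have c: "scl c z = \<rho> c *\<^sub>R z + \<sigma> c *\<^sub>R scl i z" for z
        by (subst \<rho>[of c]) (simp only: scale_left_distrib scl_scaleR_left scale_one)
      have ii: "scl i (scl i x) = - x" by (simp add: i)
      have "f (scl c x) = \<rho> c * f x + \<sigma> c * f (scl i x)"
        using f(1) by (simp add: c linear_add linear_scale)
      moreover have "f (scl i (scl c x)) = \<rho> c * f (scl i x) - \<sigma> c * f x"
        using f(1) by (simp only: c scale_right_distrib scl_scaleR_right ii)
          (simp add: linear_add linear_scale linear_neg linear_diff)
      ultimately have "?F (scl c x) = (\<rho> c * f x + \<sigma> c * f (scl i x)) *\<^sub>R 1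
          + (- (\<rho> c * f (scl i x) - \<sigma> c * f x)) *\<^sub>R i"
        by (simp only:)
      also have "\<dots> = (\<rho> c *\<^sub>R 1 + \<sigma> c *\<^sub>R i) * ?F x"
        by (simp add: i algebra_simps)
      also have "\<dots> = c * ?F x" using \<rho>[of c] by simp
      finally show "?F (scl c x) = c * ?F x" .
    next
      fix x
      have "norm (?F x) \<le> \<bar>f x\<bar> + \<bar>f (scl i x)\<bar> * norm i"
        by (rule order_trans[OF norm_triangle_ineq]) simp
      also have "\<dots> \<le> K * norm x + (K * (norm i * norm x)) * norm i"
        using f(2)[rule_format, of x] f(2)[rule_format, of "scl i x"]
        by (intro add_mono mult_right_mono) (auto simp: norm_scale)
      also have "\<dots> = (K + K * norm i * norm i) * norm x" by (simp add: algebra_simps)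
      finally show "norm (?F x) \<le> (K + K * norm i * norm i) * norm x" .
    qed
    then show "\<exists>F\<in>carrier (Dual scl). \<forall>x. \<rho> (F x) = f x"
      by (rule bexI[rotated]) (intro allI \<rho>_eq)
  qed
qed

text \<open>The real theorem extends the real parts over the graph, and
  \<open>real_part_exists\<close> lifts the extension to \<open>'k\<close>. The factor 2 in the
  bound comes from \<open>\<rho>\<close>; it is harmless, as the conclusion asks only for some
  bounded extension.\<close>

lemma hahn_banach:
  assumes G0: "(0, 0) \<in> G"
    and G_add: "\<And>v u v' u'. (v, u) \<in> G \<Longrightarrow> (v', u') \<in> G \<Longrightarrow> (v + v', u + u') \<in> G"
    and G_scl: "\<And>c v u. (v, u) \<in> G \<Longrightarrow> (scl c v, c * u) \<in> G"
    and bound: "\<And>v u. (v, u) \<in> G \<Longrightarrow> norm u \<le> K * norm v" and K: "0 \<le> K"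
  shows "\<exists>F\<in>carrier (Dual scl). \<forall>(v, u)\<in>G. F v = u"
proof -
  obtain \<rho> :: "'k \<Rightarrow> real" where \<rho>: "linear \<rho>" "\<And>z. \<bar>\<rho> z\<bar> \<le> 2 * norm z" "\<rho> 1 = 1"
    and lift: "\<And>f K. linear f \<Longrightarrow> (\<And>x. \<bar>f x\<bar> \<le> K * norm x) \<Longrightarrow>
      \<exists>F\<in>carrier (Dual scl). \<forall>x. \<rho> (F x) = f x"
    using real_part_exists by blast
  let ?G = "(\<lambda>(v, u). (v, \<rho> u)) ` G"
  have "real_vector.subspace ?G"
    unfolding real_vector.subspace_def
  proof (intro conjI ballI allI)
    show "0 \<in> ?G"
      using G0 linear_0[OF \<rho>(1)] by (auto simp: zero_prod_def intro!: image_eqI[of _ _ "(0, 0)"])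
  next
    fix p q assume "p \<in> ?G" "q \<in> ?G"
    then obtain v u v' u' where "(v, u) \<in> G" "(v', u') \<in> G" "p = (v, \<rho> u)" "q = (v', \<rho> u')" by auto
    then show "p + q \<in> ?G"
      using G_add linear_add[OF \<rho>(1)] by (intro image_eqI[of _ _ "(v + v', u + u')"]) auto
  next
    fix r :: real and p assume "p \<in> ?G"
    then obtain v u where "(v, u) \<in> G" "p = (v, \<rho> u)" by auto
    then show "r *\<^sub>R p \<in> ?G"
      using G_scl[of v u "of_real r"] linear_scale[OF \<rho>(1), of r u]
      by (intro image_eqI[of _ _ "(scl (of_real r) v, of_real r * u)"])
        (auto simp: scale_of_real scaleR_conv_of_real)
  qed
  moreover have "w \<le> (2 * K) * norm v" if vw: "(v, w) \<in> ?G" for v w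
  proof -
    obtain u where u: "(v, u) \<in> G" "w = \<rho> u" using vw by auto
    then show ?thesis using \<rho>(2)[of u] bound[of v u] by simp
  qed
  ultimately obtain f where f: "linear f" "\<And>x. \<bar>f x\<bar> \<le> (2 * K) * norm x"
    and fG: "\<And>v w. (v, w) \<in> ?G \<Longrightarrow> f v = w"
    using hahn_banach_real[of ?G "2 * K"] K by force
  from lift[OF f] obtain F where F: "F \<in> carrier (Dual scl)" "\<And>x. \<rho> (F x) = f x" by blast
  have "F v = u" if vu: "(v, u) \<in> G" for v u
  proof (rule ccontr)
    assume "F v \<noteq> u"
    \<comment> \<open>Real parts agree on the whole graph, which is closed under \<open>scl\<close>.
      Scaling by \<open>z\<close> would turn the discrepancy \<open>F v - u\<close> into 1, whose
      real part is not 0.\<close>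
    define z where "z = inverse (F v - u)"
    have "(scl z v, \<rho> (z * u)) \<in> ?G" using G_scl[OF vu, of z] by force
    then have "\<rho> (F (scl z v)) = \<rho> (z * u)" using fG F(2) by simp
    then have "\<rho> (z * F v) - \<rho> (z * u) = 0" by (simp add: Dual_scl F(1))
    then have "\<rho> (z * (F v - u)) = 0" by (simp add: linear_diff[OF \<rho>(1)] right_diff_distrib)
    moreover have "z * (F v - u) = 1" using \<open>F v \<noteq> u\<close> by (simp add: z_def)
    ultimately show False using \<rho>(3) by simp
  qed
  with F show ?thesis by blast
qed

text \<open>The \<open>\<ell>\<^sup>1\<close> inequality is exactly what bounds the linear extension
  of \<open>h\<close> on the span of \<open>B\<close>, with constant \<open>C * K\<close>. Applied
  to differences, the same bound shows that the relation \<open>G\<close> is single-valued.\<close>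

lemma l1_base_extension:
  assumes B: "l1_base scl \<eta> B" and C: "\<And>v. v \<in> B \<Longrightarrow> norm (h v) \<le> C" and C0: "0 \<le> C"
  shows "\<exists>f\<in>carrier (Dual scl). \<forall>v\<in>B. f v = h v"
proof -
  obtain K where K: "0 < K"
    and l1: "\<And>(p::nat) z b. b ` {1..p} \<subseteq> B \<Longrightarrow> inj_on b {1..p} \<Longrightarrow>
      (\<Sum>n=1..p. norm (z n)) \<le> K * norm (\<Sum>n=1..p. scl (z n) (b n))"
    using B unfolding l1_base_def by blast
  define G where
    "G = {(\<Sum>v\<in>S. scl (z v) v, \<Sum>v\<in>S. z v * h v) | S z. finite S \<and> S \<subseteq> B}"
  have "\<exists>f\<in>carrier (Dual scl). \<forall>(v, u)\<in>G. f v = u"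
  proof (rule hahn_banach)
    show "(0, 0) \<in> G" unfolding G_def by (auto intro!: exI[of _ "{}"])
  next
    fix v u v' u' assume "(v, u) \<in> G" "(v', u') \<in> G"
    then obtain S z S' z' where S: "finite S" "S \<subseteq> B" "v = (\<Sum>v\<in>S. scl (z v) v)" "u = (\<Sum>v\<in>S. z v * h v)"
      and S': "finite S'" "S' \<subseteq> B" "v' = (\<Sum>v\<in>S'. scl (z' v) v)" "u' = (\<Sum>v\<in>S'. z' v * h v)"
      unfolding G_def by blast
    \<comment> \<open>Coefficients are padded with 0 so that both combinations run over
      \<open>S \<union> S'\<close>.\<close>
    define y where "y v = (if v \<in> S then z v else 0)" for v
    define y' where "y' v = (if v \<in> S' then z' v else 0)" for v
    have "v = (\<Sum>v\<in>S \<union> S'. scl (y v) v)" "u = (\<Sum>v\<in>S \<union> S'. y v * h v)"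
      unfolding S y_def by (rule sum.mono_neutral_cong_left; use S S' in auto)+
    moreover have "v' = (\<Sum>v\<in>S \<union> S'. scl (y' v) v)" "u' = (\<Sum>v\<in>S \<union> S'. y' v * h v)"
      unfolding S' y'_def by (rule sum.mono_neutral_cong_left; use S S' in auto)+
    ultimately have "v + v' = (\<Sum>v\<in>S \<union> S'. scl (y v + y' v) v)"
      "u + u' = (\<Sum>v\<in>S \<union> S'. (y v + y' v) * h v)"
      by (simp_all add: scale_left_distrib distrib_right sum.distrib)
    moreover have "finite (S \<union> S')" "S \<union> S' \<subseteq> B" using S S' by auto
    ultimately show "(v + v', u + u') \<in> G"
      unfolding G_def mem_Collect_eq by (intro exI[of _ "S \<union> S'"] exI[of _ "\<lambda>v. y v + y' v"]) simp
  next
    fix c v u assume "(v, u) \<in> G"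
    then obtain S z where S: "finite S" "S \<subseteq> B" "v = (\<Sum>v\<in>S. scl (z v) v)" "u = (\<Sum>v\<in>S. z v * h v)"
      unfolding G_def by blast
    have "scl c v = (\<Sum>v\<in>S. scl (c * z v) v)" "c * u = (\<Sum>v\<in>S. (c * z v) * h v)"
      by (simp_all add: S scale_sum_right sum_distrib_left mult.assoc)
    with S(1,2) show "(scl c v, c * u) \<in> G"
      unfolding G_def mem_Collect_eq by (intro exI[of _ S] exI[of _ "\<lambda>v. c * z v"]) simp
  next
    fix v u assume "(v, u) \<in> G"
    then obtain S z where S: "finite S" "S \<subseteq> B" "v = (\<Sum>v\<in>S. scl (z v) v)" "u = (\<Sum>v\<in>S. z v * h v)"
      unfolding G_def by blast
    \<comment> \<open>The base inequality speaks of enumerations starting at 1, so the support is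
      enumerated accordingly.\<close>
    obtain b where b: "bij_betw b {1..card S} S"
      using ex_bij_betw_nat_finite_1[OF S(1)] by blast
    then have inj: "inj_on b {1..card S}" and img: "b ` {1..card S} = S"
      by (auto simp: bij_betw_def)
    have reindex: "(\<Sum>v\<in>S. g v) = (\<Sum>n=1..card S. g (b n))" for g :: "'a \<Rightarrow> 'x::comm_monoid_add"
      using sum.reindex_bij_betw[OF b, of g] by simp
    have "norm u \<le> (\<Sum>v\<in>S. norm (z v * h v))" unfolding S by (rule norm_sum)
    also have "\<dots> \<le> (\<Sum>v\<in>S. norm (z v) * C)"
      unfolding norm_mult using C S(2) by (intro sum_mono mult_left_mono) auto
    also have "\<dots> = C * (\<Sum>n=1..card S. norm (z (b n)))"
      unfolding reindex by (simp add: sum_distrib_left mult.commute)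
    also have "\<dots> \<le> C * (K * norm (\<Sum>n=1..card S. scl (z (b n)) (b n)))"
      using l1[of b "card S" "\<lambda>n. z (b n)"] inj img S(2) C0 by (intro mult_left_mono) auto
    also have "(\<Sum>n=1..card S. scl (z (b n)) (b n)) = v"
      unfolding S by (rule sum.reindex_bij_betw[OF b])
    finally show "norm u \<le> (C * K) * norm v" by simp
  next
    show "0 \<le> C * K" using C0 K by simp
  qed
  then obtain f where f: "f \<in> carrier (Dual scl)" and ext: "\<forall>(v, u)\<in>G. f v = u" by blast
  have mem: "(v, h v) \<in> G" if "v \<in> B" for v
    unfolding G_def mem_Collect_eq using that by (intro exI[of _ "{v}"] exI[of _ "\<lambda>_. 1"]) simp
  have "f v = h v" if "v \<in> B" for v using bspec[OF ext mem[OF that]] by simp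
  with f show ?thesis by blast
qed

end

section \<open>The quotient by the weakly almost periodic functionals\<close>

lemma linf_simps [simp]:
  "add (linf I) x y = (\<lambda>i\<in>I. x i + y i)"
  "smul (linf I) c x = (\<lambda>i\<in>I. c * x i)"
  by (simp_all add: linf_def)

lemma carrier_linf_iff: "x \<in> carrier (linf I) \<longleftrightarrow> x \<in> extensional I \<and> (\<exists>C. \<forall>i\<in>I. norm (x i) \<le> C)"
  by (auto simp: linf_def bounded_iff)

lemma linf_norm_ge:
  assumes "x \<in> carrier (linf I)" "i \<in> I"
  shows "norm (x i) \<le> nrm (linf I) x"
proof -
  have "bdd_above ((\<lambda>i. norm (x i)) ` I)"
    using assms(1) by (auto simp: carrier_linf_iff intro: bdd_aboveI2)
  then show ?thesis using assms(2) by (auto simp: linf_def intro: cSUP_upper)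
qed

lemma linf_norm_least:
  assumes "I \<noteq> {}" "\<And>i. i \<in> I \<Longrightarrow> norm (x i) \<le> C"
  shows "nrm (linf I) x \<le> C"
  using assms by (auto simp: linf_def intro: cSUP_least)

context banach_algebra
begin

definition coset :: "('a \<Rightarrow> 'k) \<Rightarrow> ('a \<Rightarrow> 'k) set" where
  "coset f = {\<lambda>x. f x + w x | w. w \<in> WAP scl}"

abbreviation "WAP_quotient \<equiv> quotient_space (Dual scl) (WAP scl)"

lemma coset_self: "f \<in> coset f"
  unfolding coset_def using zero_in_WAP by force

lemma coset_subset_Dual: "f \<in> carrier (Dual scl) \<Longrightarrow> coset f \<subseteq> carrier (Dual scl)"
  unfolding coset_def using WAP_subset_Dual by (auto intro!: Dual_closed(1))

lemma carrier_WAP_quotient: "carrier WAP_quotient = coset ` carrier (Dual scl)"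
  by (auto simp: quotient_space_def coset_def)

lemma add_coset: "add WAP_quotient (coset f) (coset g) = coset (\<lambda>x. f x + g x)"
proof -
  have "(\<lambda>x. p x + q x) \<in> coset (\<lambda>x. f x + g x)" if "p \<in> coset f" "q \<in> coset g" for p q
  proof -
    obtain v w where vw: "v \<in> WAP scl" "w \<in> WAP scl" "p = (\<lambda>x. f x + v x)" "q = (\<lambda>x. g x + w x)"
      using \<open>p \<in> coset f\<close> \<open>q \<in> coset g\<close> by (auto simp: coset_def)
    show ?thesis unfolding coset_def mem_Collect_eq
      by (intro exI[of _ "\<lambda>x. v x + w x"]) (auto simp: vw WAP_add algebra_simps)
  qed
  moreover have "\<exists>p q. r = (\<lambda>x. p x + q x) \<and> p \<in> coset f \<and> q \<in> coset g"
    if r: "r \<in> coset (\<lambda>x. f x + g x)" for r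
  proof -
    obtain w where w: "w \<in> WAP scl" "r = (\<lambda>x. f x + g x + w x)" using r by (auto simp: coset_def)
    show ?thesis
      by (intro exI[of _ f] exI[of _ "\<lambda>x. g x + w x"]) (use w coset_self in \<open>auto simp: coset_def add.assoc\<close>)
  qed
  ultimately show ?thesis by (auto simp: quotient_space_def)
qed

lemma smul_coset: "smul WAP_quotient c (coset f) = coset (\<lambda>x. c * f x)"
proof -
  have "(\<lambda>x. c * p x + w x) \<in> coset (\<lambda>x. c * f x)" if "p \<in> coset f" "w \<in> WAP scl" for p w
  proof -
    obtain v where v: "v \<in> WAP scl" "p = (\<lambda>x. f x + v x)"
      using \<open>p \<in> coset f\<close> by (auto simp: coset_def)
    show ?thesis unfolding coset_def mem_Collect_eq
      by (intro exI[of _ "\<lambda>x. c * v x + w x"]) (auto simp: v that WAP_add WAP_scale algebra_simps)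
  qed
  moreover have "\<exists>p w. r = (\<lambda>x. c * p x + w x) \<and> p \<in> coset f \<and> w \<in> WAP scl"
    if r: "r \<in> coset (\<lambda>x. c * f x)" for r
    using r coset_self[of f] unfolding coset_def[of "\<lambda>x. c * f x"] by blast
  ultimately show ?thesis by (auto simp: quotient_space_def)
qed

lemma WAP_quotient_norm: "nrm WAP_quotient P = Inf (nrm (Dual scl) ` P)"
  by (simp add: quotient_space_def)

lemma WAP_quotient_norm_nonneg:
  assumes "P \<in> carrier WAP_quotient"
  shows "0 \<le> nrm WAP_quotient P"
  unfolding WAP_quotient_norm
proof (rule cInf_greatest)
  obtain f where f: "f \<in> carrier (Dual scl)" "P = coset f" using assms by (auto simp: carrier_WAP_quotient)
  then show "nrm (Dual scl) ` P \<noteq> {}" using coset_self by blast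
  show "0 \<le> x" if "x \<in> nrm (Dual scl) ` P" for x
    using that f coset_subset_Dual Dual_norm_nonneg by blast
qed

lemma WAP_quotient_closed:
  assumes "P \<in> carrier WAP_quotient"
  shows "P' \<in> carrier WAP_quotient \<Longrightarrow> add WAP_quotient P P' \<in> carrier WAP_quotient"
    and "smul WAP_quotient c P \<in> carrier WAP_quotient"
  using assms by (auto simp: carrier_WAP_quotient add_coset smul_coset intro!: imageI Dual_closed)

text \<open>Invariance makes the chosen representative immaterial, and the bound, valid for every
  representative, passes to the infimum over the coset. Replacing \<open>M\<close> by
  \<open>N\<close> permits the division there.\<close>

lemma WAP_quotient_lift:
  assumes T: "bounded_linear_map (Dual scl) Y T"
    and inv: "\<And>f w. f \<in> carrier (Dual scl) \<Longrightarrow> w \<in> WAP scl \<Longrightarrow> T (\<lambda>x. f x + w x) = T f"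
  shows "\<exists>S. bounded_linear_map WAP_quotient Y S \<and> (\<forall>f\<in>carrier (Dual scl). S (coset f) = T f)"
proof -
  define S where "S P = T (SOME p. p \<in> P)" for P
  have T_coset: "T p = T f" if "p \<in> coset f" "f \<in> carrier (Dual scl)" for p f
    using that inv by (auto simp: coset_def)
  have S: "S (coset f) = T f" if "f \<in> carrier (Dual scl)" for f
    unfolding S_def using T_coset[OF someI[of "\<lambda>p. p \<in> coset f", OF coset_self] that] .
  obtain M where M: "\<And>f. f \<in> carrier (Dual scl) \<Longrightarrow> nrm Y (T f) \<le> M * nrm (Dual scl) f"
    using T unfolding bounded_linear_map_def by blast
  define N where "N = max M 1"
  have N: "0 < N" by (simp add: N_def)
  have "nrm Y (T f) \<le> N * nrm WAP_quotient (coset f)" if f: "f \<in> carrier (Dual scl)" for f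
  proof -
    have "nrm Y (T f) / N \<le> nrm WAP_quotient (coset f)"
      unfolding WAP_quotient_norm
    proof (rule cInf_greatest)
      show "nrm (Dual scl) ` coset f \<noteq> {}" using coset_self by blast
      fix x assume "x \<in> nrm (Dual scl) ` coset f"
      then obtain p where p: "p \<in> coset f" "x = nrm (Dual scl) p" by blast
      have pD: "p \<in> carrier (Dual scl)" using p f coset_subset_Dual by blast
      have "nrm Y (T f) \<le> M * x" using M[OF pD] T_coset[OF p(1) f] p(2) by simp
      also have "\<dots> \<le> N * x"
        using Dual_norm_nonneg[OF pD] p(2) by (intro mult_right_mono) (auto simp: N_def)
      finally show "nrm Y (T f) / N \<le> x" using N by (simp add: field_simps)
    qed
    then show ?thesis using N by (simp add: field_simps)
  qed
  then have "bounded_linear_map WAP_quotient Y S"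
    using T unfolding bounded_linear_map_def
    by (auto simp: carrier_WAP_quotient add_coset smul_coset S Dual_closed intro!: exI[of _ N])
  with S show ?thesis by blast
qed

section \<open>The dual as an isometric copy inside \<open>\<ell>\<^sup>\<infinity>\<close>\<close>

text \<open>The division by 0 at \<open>d i = 0\<close> is harmless, as \<open>f 0 = 0\<close>.\<close>

definition sample :: "'i set \<Rightarrow> ('i \<Rightarrow> 'a) \<Rightarrow> ('a \<Rightarrow> 'k) \<Rightarrow> 'i \<Rightarrow> 'k" where
  "sample I d f = (\<lambda>i\<in>I. f (d i) / of_real (norm (d i)))"

lemma sample_eq:
  assumes "f \<in> carrier (Dual scl)" "i \<in> I"
  shows "f (d i) = of_real (norm (d i)) * sample I d f i"
  using assms by (cases "d i = 0") (auto simp: sample_def Dual_zero)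

lemma sample_in_linf:
  assumes f: "f \<in> carrier (Dual scl)"
  shows "sample I d f \<in> carrier (linf I)"
  unfolding carrier_linf_iff
proof (intro conjI exI ballI)
  show "sample I d f \<in> extensional I" by (simp add: sample_def)
next
  fix i assume "i \<in> I"
  then show "norm (sample I d f i) \<le> nrm (Dual scl) f"
    using Dual_norm_le[OF f, of "d i"] Dual_norm_nonneg[OF f]
    by (cases "d i = 0") (auto simp: sample_def norm_divide field_simps)
qed

lemma sample_linear:
  "sample I d (\<lambda>x. f x + g x) = add (linf I) (sample I d f) (sample I d g)"
  "sample I d (\<lambda>x. c * f x) = smul (linf I) c (sample I d f)"
  by (auto simp: sample_def add_divide_distrib)

lemma Dual_bound_dense:
  assumes f: "f \<in> carrier (Dual scl)" and dense: "closure (d ` I) = UNIV"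
    and bound: "\<And>i. i \<in> I \<Longrightarrow> norm (f (d i)) \<le> C * norm (d i)"
  shows "norm (f x) \<le> C * norm x"
proof -
  have "bounded_linear f"
    by (rule bounded_linear_intro[where K = "nrm (Dual scl) f"])
      (use Dual_norm_le[OF f] in \<open>auto simp: Dual_add Dual_scaleR f scaleR_conv_of_real mult.commute\<close>)
  then have "continuous_on UNIV f" by (intro linear_continuous_on)
  then have "closed {x. norm (f x) \<le> C * norm x}"
    by (intro closed_Collect_le continuous_intros)
  moreover have "d ` I \<subseteq> {x. norm (f x) \<le> C * norm x}" using bound by auto
  ultimately have "closure (d ` I) \<subseteq> {x. norm (f x) \<le> C * norm x}" by (rule closure_minimal[rotated])
  with dense show ?thesis by auto
qed

lemma sample_norm_ge:
  assumes f: "f \<in> carrier (Dual scl)" and dense: "closure (d ` I) = UNIV" and I: "I \<noteq> {}"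
  shows "nrm (Dual scl) f \<le> nrm (linf I) (sample I d f)"
proof (rule Dual_norm_least)
  fix x show "norm (f x) \<le> nrm (linf I) (sample I d f) * norm x"
  proof (rule Dual_bound_dense[OF f dense])
    fix i assume i: "i \<in> I"
    show "norm (f (d i)) \<le> nrm (linf I) (sample I d f) * norm (d i)"
      using linf_norm_ge[OF sample_in_linf[OF f] i, of d]
      by (subst sample_eq[OF f i]) (simp add: norm_mult mult.commute[of _ "norm (d i)"] mult_left_mono)
  qed
next
  obtain i where "i \<in> I" using I by blast
  then show "0 \<le> nrm (linf I) (sample I d f)"
    using linf_norm_ge[OF sample_in_linf[OF f], of i I d] norm_ge_zero order_trans by blast
qed

lemma sample_inj:
  assumes dense: "closure (d ` I) = UNIV"
  shows "inj_on (sample I d) (carrier (Dual scl))"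
proof (rule inj_onI)
  fix f g assume fg: "f \<in> carrier (Dual scl)" "g \<in> carrier (Dual scl)" and eq: "sample I d f = sample I d g"
  have D: "(\<lambda>x. f x + - 1 * g x) \<in> carrier (Dual scl)"
    by (rule Dual_closed(1)[OF fg(1) Dual_closed(2)[OF fg(2)]])
  have "norm (f x + - 1 * g x) \<le> 0 * norm x" for x
    by (rule Dual_bound_dense[OF D dense]) (use eq fg in \<open>simp add: sample_eq\<close>)
  then show "f = g" by auto
qed

text \<open>The approximating functionals are uniformly bounded, so a pointwise limit along an
  ultrafilter on the naturals lies in the dual, and its samples are the limits of theirs, namely
  \<open>y\<close>.\<close>

lemma sample_range_closed:
  assumes dense: "closure (d ` I) = UNIV" and y: "y \<in> carrier (linf I)"
    and approx: "\<And>e. 0 < e \<Longrightarrow> \<exists>g\<in>carrier (Dual scl). \<forall>i\<in>I. norm (y i - sample I d g i) \<le> e"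
  shows "y \<in> sample I d ` carrier (Dual scl)"
proof -
  have "\<forall>n. \<exists>g\<in>carrier (Dual scl). \<forall>i\<in>I. norm (y i - sample I d g i) \<le> 1 / real (Suc n)"
    using approx by simp
  then obtain g where g: "\<And>n. g n \<in> carrier (Dual scl)"
    and gy: "\<And>n i. i \<in> I \<Longrightarrow> norm (y i - sample I d (g n) i) \<le> 1 / real (Suc n)" by metis
  obtain C where C: "\<And>i. i \<in> I \<Longrightarrow> norm (y i) \<le> C" using y by (auto simp: carrier_linf_iff)
  \<comment> \<open>The summand 1 absorbs the approximation errors
    \<open>1 / real (Suc n)\<close>.\<close>
  have g_bound: "norm (g n x) \<le> (C + 1) * norm x" for n x
  proof (rule Dual_bound_dense[OF g dense])
    fix i assume i: "i \<in> I"
    have "norm (sample I d (g n) i) \<le> norm (y i) + norm (y i - sample I d (g n) i)"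
      by (metis norm_minus_commute norm_triangle_sub)
    also have "\<dots> \<le> C + 1"
      using C[OF i] gy[OF i, of n] by (intro add_mono) (auto intro: order_trans)
    finally show "norm (g n (d i)) \<le> (C + 1) * norm (d i)"
      by (subst sample_eq[OF g i]) (simp add: norm_mult mult.commute[of _ "norm (d i)"] mult_left_mono)
  qed
  obtain V :: "nat filter" where V: "ultrafilter V" "V \<le> sequentially"
    using ultrafilter_finer_exists[of "sequentially"] by auto
  define f where "f x = Lim V (\<lambda>n. g n x)" for x
  have ev: "eventually (\<lambda>n. g n \<in> carrier (Dual scl) \<and> (\<forall>x. norm (g n x) \<le> (C + 1) * norm x)) V"
    using g g_bound by simp
  have f: "f \<in> carrier (Dual scl)" unfolding f_def by (rule Dual_Lim(2)[OF V(1) ev])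
  have lim: "((\<lambda>n. g n x) \<longlongrightarrow> f x) V" for x unfolding f_def by (rule Dual_Lim(1)[OF V(1) ev])
  have "y i = sample I d f i" if i: "i \<in> I" for i
  proof (rule tendsto_unique)
    show "V \<noteq> bot" using V(1) by (simp add: ultrafilter_def)
    have "((\<lambda>n. g n (d i) * inverse (of_real (norm (d i)))) \<longlongrightarrow> f (d i) * inverse (of_real (norm (d i)))) V"
      by (intro tendsto_mult lim tendsto_const)
    then show "((\<lambda>n. sample I d (g n) i) \<longlongrightarrow> sample I d f i) V"
      using i by (simp add: sample_def divide_inverse)
    have "(\<lambda>n. sample I d (g n) i - y i) \<longlonglongrightarrow> 0"
      by (rule Lim_null_comparison[OF _ LIMSEQ_inverse_real_of_nat])
        (use gy[OF i] in \<open>simp add: norm_minus_commute inverse_eq_divide\<close>)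
    then have "(\<lambda>n. sample I d (g n) i) \<longlonglongrightarrow> y i" by (rule LIM_zero_cancel)
    then show "((\<lambda>n. sample I d (g n) i) \<longlongrightarrow> y i) V" using V(2) by (rule tendsto_mono[rotated])
  qed
  moreover have "y \<in> extensional I" using y by (simp add: carrier_linf_iff)
  ultimately have "y = sample I d f"
    by (intro extensionalityI[of y I]) (auto simp: sample_def)
  with f show ?thesis by blast
qed

text \<open>\<open>R\<close> is the preimage under \<open>S\<close> of the sampled dual, and
  \<open>T\<close> undoes the sampling after \<open>S\<close>. Closedness of the sampled dual and
  boundedness of \<open>S\<close> make \<open>R\<close> closed; \<open>T\<close> is bounded because
  sampling on a dense set does not decrease norms.\<close>

lemma extremely_non_arens_regularI:
  fixes d :: "'i \<Rightarrow> 'a"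
  assumes dense: "closure (d ` I) = UNIV" and I: "I \<noteq> {}"
    and S: "bounded_linear_map WAP_quotient (linf I) S"
    and onto: "S ` carrier WAP_quotient = carrier (linf I)"
  shows "extremely_non_arens_regular scl"
proof -
  let ?Q = "WAP_quotient" and ?D = "carrier (Dual scl)" and ?j = "sample I d"
  have S_linf: "S P \<in> carrier (linf I)" if "P \<in> carrier ?Q" for P
    using onto that by blast
  have S_add: "S (add ?Q P P') = add (linf I) (S P) (S P')" if "P \<in> carrier ?Q" "P' \<in> carrier ?Q" for P P'
    using S that by (simp add: bounded_linear_map_def)
  have S_smul: "S (smul ?Q c P) = smul (linf I) c (S P)" if "P \<in> carrier ?Q" for P c
    using S that by (simp add: bounded_linear_map_def)
  obtain M where M: "\<And>P. P \<in> carrier ?Q \<Longrightarrow> nrm (linf I) (S P) \<le> M * nrm ?Q P"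
    using S unfolding bounded_linear_map_def by blast
  define R where "R = {P \<in> carrier ?Q. S P \<in> ?j ` ?D}"
  define T where "T P = inv_into ?D ?j (S P)" for P
  have T: "T P \<in> ?D" "?j (T P) = S P" if "P \<in> R" for P
    using that by (auto simp: R_def T_def f_inv_into_f intro!: inv_into_into)
  have T_eq: "T P = f" if "S P = ?j f" "f \<in> ?D" for P f
    unfolding T_def that(1) using that(2) by (rule inv_into_f_f[OF sample_inj[OF dense]])
  have R_add: "add ?Q P P' \<in> R" and T_add: "T (add ?Q P P') = (\<lambda>x. T P x + T P' x)"
    if P: "P \<in> R" "P' \<in> R" for P P'
  proof -
    have D: "(\<lambda>x. T P x + T P' x) \<in> ?D" using T P by (intro Dual_closed)
    have eq: "S (add ?Q P P') = ?j (\<lambda>x. T P x + T P' x)"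
      using P T S_add by (simp only: sample_linear) (simp add: R_def)
    show "add ?Q P P' \<in> R" using P D eq by (simp add: R_def WAP_quotient_closed)
    show "T (add ?Q P P') = (\<lambda>x. T P x + T P' x)" by (rule T_eq[OF eq D])
  qed
  have R_smul: "smul ?Q c P \<in> R" and T_smul: "T (smul ?Q c P) = (\<lambda>x. c * T P x)"
    if P: "P \<in> R" for c P
  proof -
    have D: "(\<lambda>x. c * T P x) \<in> ?D" using T P by (intro Dual_closed)
    have eq: "S (smul ?Q c P) = ?j (\<lambda>x. c * T P x)"
      using P T S_smul by (simp only: sample_linear) (simp add: R_def)
    show "smul ?Q c P \<in> R" using P D eq by (simp add: R_def WAP_quotient_closed)
    show "T (smul ?Q c P) = (\<lambda>x. c * T P x)" by (rule T_eq[OF eq D])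
  qed
  have T_onto: "\<exists>P\<in>R. T P = f" if f: "f \<in> ?D" for f
  proof -
    obtain P where P: "P \<in> carrier ?Q" "S P = ?j f"
      using onto sample_in_linf[OF f, of I d] by (metis imageE)
    then have "P \<in> R" using f by (simp add: R_def)
    with T_eq[OF P(2) f] show ?thesis by blast
  qed
  have "closed_subspace ?Q R"
    unfolding closed_subspace_def
  proof (intro conjI ballI allI impI)
    show "R \<subseteq> carrier ?Q" by (auto simp: R_def)
    show "R \<noteq> {}" using T_onto[OF zero_in_Dual] by blast
  next
    fix P assume P: "P \<in> carrier ?Q"
      and approx: "\<forall>e>0. \<exists>s\<in>R. nrm ?Q (add ?Q P (smul ?Q (- 1) s)) < e"
    have "S P \<in> ?j ` ?D"
    proof (rule sample_range_closed[OF dense S_linf[OF P]])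
      fix e :: real assume e: "0 < e"
      \<comment> \<open>\<open>\<bar>M\<bar> + 1\<close> is a positive bound for \<open>S\<close>
        whatever the sign of \<open>M\<close>.\<close>
      have "0 < e / (\<bar>M\<bar> + 1)" using e by simp
      with approx obtain s where s: "s \<in> R" "nrm ?Q (add ?Q P (smul ?Q (- 1) s)) < e / (\<bar>M\<bar> + 1)"
        by blast
      let ?P = "add ?Q P (smul ?Q (- 1) s)"
      have sQ: "s \<in> carrier ?Q" "smul ?Q (- 1) s \<in> carrier ?Q"
        using s(1) by (auto simp: R_def WAP_quotient_closed)
      have PQ: "?P \<in> carrier ?Q" by (rule WAP_quotient_closed(1)[OF P sQ(2)])
      have "nrm (linf I) (S ?P) \<le> M * nrm ?Q ?P" by (rule M[OF PQ])
      also have "\<dots> \<le> (\<bar>M\<bar> + 1) * nrm ?Q ?P"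
        by (intro mult_right_mono WAP_quotient_norm_nonneg PQ) linarith
      also have "\<dots> \<le> e" using s(2) by (simp add: field_simps)
      finally have le: "nrm (linf I) (S ?P) \<le> e" .
      have "norm (S P i - ?j (T s) i) \<le> e" if i: "i \<in> I" for i
      proof -
        have "S ?P i = S P i - ?j (T s) i"
          using i T(2)[OF s(1)] by (simp add: S_add S_smul P sQ)
        with linf_norm_ge[OF S_linf[OF PQ] i] le show ?thesis by simp
      qed
      with T(1)[OF s(1)] show "\<exists>g\<in>?D. \<forall>i\<in>I. norm (S P i - ?j g i) \<le> e" by blast
    qed
    with P show "P \<in> R" by (simp add: R_def)
  qed (use R_add R_smul in auto)
  moreover have "bounded_linear_map (?Q\<lparr>carrier := R\<rparr>) (Dual scl) T"
    unfolding bounded_linear_map_def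
  proof (intro conjI ballI allI exI)
    fix P assume "P \<in> carrier (?Q\<lparr>carrier := R\<rparr>)"
    then have P: "P \<in> R" by simp
    have "nrm (Dual scl) (T P) \<le> nrm (linf I) (S P)"
      using sample_norm_ge[OF T(1)[OF P] dense I] T(2)[OF P] by simp
    also have "\<dots> \<le> M * nrm ?Q P" using P by (intro M) (simp add: R_def)
    finally show "nrm (Dual scl) (T P) \<le> M * nrm (?Q\<lparr>carrier := R\<rparr>) P" by simp
  qed (use T T_add T_smul in auto)
  moreover have "T ` R = ?D" using T T_onto by blast
  ultimately show ?thesis unfolding extremely_non_arens_regular_def by blast
qed

end

section \<open>Cofinal subnets of weak TI-nets\<close>

lemma eventually_tails:
  assumes dir: "directed_set L le" and L: "L \<noteq> {}"
  shows "eventually P (tails L le) \<longleftrightarrow> (\<exists>\<xi>\<in>L. \<forall>\<alpha>\<in>L. (\<xi>, \<alpha>) \<in> le \<longrightarrow> P \<alpha>)"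
  unfolding tails_def
proof (subst eventually_INF_base[OF L])
  fix \<alpha> \<beta> assume "\<alpha> \<in> L" "\<beta> \<in> L"
  then obtain \<gamma> where "\<gamma> \<in> L" "(\<alpha>, \<gamma>) \<in> le" "(\<beta>, \<gamma>) \<in> le"
    using dir unfolding directed_set_def by blast
  moreover have "trans le" using dir by (simp add: directed_set_def preorder_on_def)
  ultimately show "\<exists>x\<in>L. principal {\<alpha> \<in> L. (x, \<alpha>) \<in> le}
      \<le> inf (principal {\<alpha>' \<in> L. (\<alpha>, \<alpha>') \<in> le}) (principal {\<alpha> \<in> L. (\<beta>, \<alpha>) \<in> le})"
    by (intro bexI[of _ \<gamma>]) (auto dest: transD)
qed (auto simp: eventually_principal)

lemma tails_nontrivial:
  assumes dir: "directed_set L le" and L: "L \<noteq> {}"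
  shows "tails L le \<noteq> bot"
proof -
  have "refl_on L le" using dir by (simp add: directed_set_def preorder_on_def)
  then show ?thesis
    unfolding trivial_limit_def eventually_tails[OF assms] by (auto dest: refl_onD)
qed

lemma filterlim_strict_upper:
  assumes dir: "directed_set L le" and L: "L \<noteq> {}"
    and y: "\<And>\<xi>. \<xi> \<in> L \<Longrightarrow> y \<xi> \<in> strict_upper L le \<xi>"
  shows "filterlim y (tails L le) (tails L le)"
  unfolding filterlim_iff
proof (intro allI impI)
  fix P assume "eventually P (tails L le)"
  then obtain \<xi> where \<xi>: "\<xi> \<in> L" "\<And>\<alpha>. \<alpha> \<in> L \<Longrightarrow> (\<xi>, \<alpha>) \<in> le \<Longrightarrow> P \<alpha>"
    by (auto simp: eventually_tails[OF dir L])
  have "trans le" using dir by (simp add: directed_set_def preorder_on_def)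
  then have "P (y \<alpha>)" if "\<alpha> \<in> L" "(\<xi>, \<alpha>) \<in> le" for \<alpha>
    using y[OF that(1)] that(2) by (intro \<xi>(2)) (auto simp: strict_upper_def dest: transD)
  with \<xi>(1) show "eventually (\<lambda>\<alpha>. P (y \<alpha>)) (tails L le)"
    by (auto simp: eventually_tails[OF dir L])
qed

text \<open>\<open>J\<close> is the set of slots, one per subnet. Injectivity in the pair lets the
  slot be recovered from the value, which is how a functional can later be prescribed slot by
  slot.\<close>

lemma disjoint_cofinal_maps:
  assumes \<eta>: "Cinfinite \<eta>" and L: "|L| \<le>o \<eta>" and J: "|J| \<le>o \<eta>"
    and upper: "\<And>\<xi>. \<xi> \<in> L \<Longrightarrow> \<eta> \<le>o |strict_upper L le \<xi>|"
  shows "\<exists>y. inj_on (\<lambda>(\<xi>, j). y \<xi> j) (L \<times> J) \<and>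
    (\<forall>\<xi>\<in>L. \<forall>j\<in>J. y \<xi> j \<in> strict_upper L le \<xi>)"
proof -
  have "|L \<times> J| \<le>o \<eta>"
    using \<eta> L J by (intro card_of_Times_ordLeq_infinite_Field) (auto simp: cinfinite_def)
  then have "|L \<times> J| \<le>o |strict_upper L le (fst p)|" if "p \<in> L \<times> J" for p
    using upper[of "fst p"] that by (auto intro: ordLeq_transitive)
  from injective_choice[of "L \<times> J" "\<lambda>p. strict_upper L le (fst p)", OF this] obtain g
    where "inj_on g (L \<times> J)" "\<forall>p\<in>L \<times> J. g p \<in> strict_upper L le (fst p)" by blast
  then show ?thesis by (intro exI[of _ "curry g"]) auto
qed

context banach_algebra
begin

text \<open>For fixed outer index the outer element is a member of the net, so the TI limits along
  the tails apply to it; composing them with \<open>y\<close> or \<open>y'\<close> transfers them to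
  \<open>U\<close>.\<close>

lemma weak_TI_net_absorbing:
  assumes TI: "weak_TI_net L le a" and L: "L \<noteq> {}" and M: "\<And>\<alpha>. \<alpha> \<in> L \<Longrightarrow> norm (a \<alpha>) \<le> M"
    and U: "ultrafilter U" "U \<le> tails L le"
    and y: "\<And>\<xi>. \<xi> \<in> L \<Longrightarrow> y \<xi> \<in> strict_upper L le \<xi>"
    and y': "\<And>\<xi>. \<xi> \<in> L \<Longrightarrow> y' \<xi> \<in> strict_upper L le \<xi>"
  shows "absorbing_nets scl U (\<lambda>\<xi>. a (y \<xi>)) (\<lambda>\<xi>. a (y' \<xi>)) M"
proof -
  have dir: "directed_set L le" using TI by (simp add: weak_TI_net_def)
  have inL: "y \<xi> \<in> L" "y' \<xi> \<in> L" if "\<xi> \<in> L" for \<xi>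
    using y[OF that] y'[OF that] by (auto simp: strict_upper_def)
  obtain \<xi>0 where "\<xi>0 \<in> L" using L by blast
  then have "eventually (\<lambda>\<xi>. \<xi> \<in> L) (tails L le)"
    by (auto simp: eventually_tails[OF dir L])
  then have ev: "eventually (\<lambda>\<xi>. \<xi> \<in> L) U" using U(2) by (rule filter_leD[rotated])
  have lim_y: "filterlim y (tails L le) U" "filterlim y' (tails L le) U"
    by (rule filterlim_mono[OF filterlim_strict_upper[OF dir L] order_refl U(2)], fact)+
  have TI_lim: "((\<lambda>\<alpha>. a \<alpha> * a \<beta> - a \<alpha>) \<longlongrightarrow> 0) (tails L le)"
    "((\<lambda>\<alpha>. a \<beta> * a \<alpha> - a \<alpha>) \<longlongrightarrow> 0) (tails L le)" if "\<beta> \<in> L" for \<beta>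
    using TI that by (auto simp: weak_TI_net_def intro: tendsto_norm_zero_cancel)
  show ?thesis
  proof
    show "ultrafilter U" by (rule U(1))
    show "eventually (\<lambda>\<xi>. norm (a (y \<xi>)) \<le> M) U"
      using ev by eventually_elim (intro M inL)
    show "eventually (\<lambda>\<xi>. norm (a (y' \<xi>)) \<le> M) U"
      using ev by eventually_elim (intro M inL)
    show "eventually (\<lambda>\<zeta>. ((\<lambda>\<xi>. a (y \<zeta>) * a (y' \<xi>) - a (y' \<xi>)) \<longlongrightarrow> 0) U) U"
      using ev by eventually_elim (rule filterlim_compose[OF TI_lim(2)[OF inL(1)] lim_y(2)])
    show "eventually (\<lambda>\<zeta>. ((\<lambda>\<xi>. a (y \<xi>) * a (y' \<zeta>) - a (y \<xi>)) \<longlongrightarrow> 0) U) U"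
      using ev by eventually_elim (rule filterlim_compose[OF TI_lim(1)[OF inL(2)] lim_y(1)])
  qed
qed

text \<open>Limits along two subnets agree on \<open>WAP\<close>, so subtracting the one along
  \<open>b\<close> yields a map that descends to the quotient.\<close>

definition limit_differences ::
    "'i set \<Rightarrow> 'l filter \<Rightarrow> ('l \<Rightarrow> 'a) \<Rightarrow> ('i \<Rightarrow> 'l \<Rightarrow> 'a) \<Rightarrow> ('a \<Rightarrow> 'k) \<Rightarrow> 'i \<Rightarrow> 'k" where
  "limit_differences I U b c f = (\<lambda>i\<in>I. limit_functional U (c i) f - limit_functional U b f)"

lemma limit_differences_bounded_linear_map:
  assumes I: "I \<noteq> {}" and abs: "\<And>i. i \<in> I \<Longrightarrow> absorbing_nets scl U b (c i) M"
  shows "bounded_linear_map (Dual scl) (linf I) (limit_differences I U b c)"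
proof -
  let ?D = "carrier (Dual scl)" and ?T = "limit_differences I U b c"
  have bd: "norm (limit_functional U (c i) f - limit_functional U b f) \<le> 2 * M * nrm (Dual scl) f"
    if "i \<in> I" "f \<in> ?D" for i f
  proof -
    interpret absorbing_nets scl U b "c i" M by (rule abs[OF that(1)])
    show ?thesis
      using limit_functional_tendsto(2)[OF U c_bounded that(2)]
        limit_functional_tendsto(2)[OF U b_bounded that(2)]
        norm_triangle_ineq4[of "limit_functional U (c i) f" "limit_functional U b f"] by linarith
  qed
  have Bidual: "limit_functional U (c i) \<in> carrier (Bidual scl)"
    "limit_functional U b \<in> carrier (Bidual scl)" if "i \<in> I" for i
  proof -
    interpret absorbing_nets scl U b "c i" M by (rule abs[OF that])
    show "limit_functional U (c i) \<in> carrier (Bidual scl)"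
      "limit_functional U b \<in> carrier (Bidual scl)"
      by (rule limit_functional_in_Bidual[OF U c_bounded], rule limit_functional_in_Bidual[OF U b_bounded])
  qed
  show ?thesis
    unfolding bounded_linear_map_def
  proof (intro conjI ballI allI exI Pi_I)
    fix f assume f: "f \<in> ?D"
    show "?T f \<in> carrier (linf I)"
      unfolding carrier_linf_iff limit_differences_def using bd[OF _ f] by (auto intro!: exI)
    show "nrm (linf I) (?T f) \<le> (2 * M) * nrm (Dual scl) f"
      by (rule linf_norm_least[OF I]) (use bd[OF _ f] in \<open>simp add: limit_differences_def\<close>)
  next
    fix f g assume "f \<in> ?D" "g \<in> ?D"
    with Bidual show "?T (add (Dual scl) f g) = add (linf I) (?T f) (?T g)"
      by (auto simp: limit_differences_def carrier_Bidual_iff)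
  next
    fix r f assume "f \<in> ?D"
    with Bidual show "?T (smul (Dual scl) r f) = smul (linf I) r (?T f)"
      by (auto simp: limit_differences_def carrier_Bidual_iff right_diff_distrib)
  qed
qed

lemma limit_differences_add_WAP:
  assumes abs: "\<And>i. i \<in> I \<Longrightarrow> absorbing_nets scl U b (c i) M"
    and f: "f \<in> carrier (Dual scl)" and w: "w \<in> WAP scl"
  shows "limit_differences I U b c (\<lambda>x. f x + w x) = limit_differences I U b c f"
proof -
  have "limit_functional U (c i) (\<lambda>x. f x + w x) - limit_functional U b (\<lambda>x. f x + w x)
      = limit_functional U (c i) f - limit_functional U b f" if i: "i \<in> I" for i
  proof -
    interpret absorbing_nets scl U b "c i" M by (rule abs[OF i])
    have "w \<in> carrier (Dual scl)" using w WAP_subset_Dual by blast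
    then show ?thesis
      using limit_functional_in_Bidual[OF U c_bounded] limit_functional_in_Bidual[OF U b_bounded]
        WAP_limits_eq[OF w] f by (simp add: carrier_Bidual_iff)
  qed
  then show ?thesis by (auto simp: limit_differences_def)
qed

text \<open>Prescribing \<open>x i\<close> on the range of \<open>y _ (Some i)\<close> and 0 elsewhere on the base is consistent,
  as these ranges are disjoint.\<close>

lemma limit_differences_onto:
  assumes U: "ultrafilter U" "eventually (\<lambda>\<xi>. \<xi> \<in> L) U"
    and base: "l1_base scl \<eta> (a ` L)" and a: "inj_on a L"
    and y: "inj_on (\<lambda>(\<xi>, j). y \<xi> j) (L \<times> insert None (Some ` I))"
      "\<And>\<xi> j. \<xi> \<in> L \<Longrightarrow> j \<in> insert None (Some ` I) \<Longrightarrow> y \<xi> j \<in> L"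
    and x: "x \<in> carrier (linf I)"
  shows "\<exists>f\<in>carrier (Dual scl).
    limit_differences I U (\<lambda>\<xi>. a (y \<xi> None)) (\<lambda>i \<xi>. a (y \<xi> (Some i))) f = x"
proof -
  let ?J = "insert None (Some ` I)"
  let ?y = "\<lambda>(\<xi>, j). y \<xi> j"
  obtain C where C: "\<And>i. i \<in> I \<Longrightarrow> norm (x i) \<le> C" using x by (auto simp: carrier_linf_iff)
  define h where "h \<alpha> = (if \<alpha> \<in> ?y ` (L \<times> ?J)
    then case snd (inv_into (L \<times> ?J) ?y \<alpha>) of None \<Rightarrow> 0 | Some i \<Rightarrow> x i else 0)" for \<alpha>
  have h_y: "h (y \<xi> j) = (case j of None \<Rightarrow> 0 | Some i \<Rightarrow> x i)" if "\<xi> \<in> L" "j \<in> ?J" for \<xi> j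
  proof -
    have mem: "(\<xi>, j) \<in> L \<times> ?J" using that by simp
    from inv_into_f_f[OF y(1) mem] have "inv_into (L \<times> ?J) ?y (y \<xi> j) = (\<xi>, j)" by simp
    moreover from imageI[OF mem, of ?y] have "y \<xi> j \<in> ?y ` (L \<times> ?J)" by simp
    ultimately show ?thesis by (simp add: h_def)
  qed
  \<comment> \<open>The absolute value gives the nonnegative bound demanded by
    \<open>l1_base_extension\<close>, also when \<open>I\<close> is empty.\<close>
  have h_bound: "norm (h \<alpha>) \<le> \<bar>C\<bar>" for \<alpha>
  proof (cases "\<alpha> \<in> ?y ` (L \<times> ?J)")
    case True
    then obtain \<xi> j where "\<xi> \<in> L" "j \<in> ?J" "\<alpha> = y \<xi> j" by auto
    then show ?thesis using h_y C by (force split: option.splits)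
  qed (auto simp: h_def)
  obtain f where f: "f \<in> carrier (Dual scl)"
    and "\<And>v. v \<in> a ` L \<Longrightarrow> f v = h (inv_into L a v)"
    using l1_base_extension[OF base, of "\<lambda>v. h (inv_into L a v)" "\<bar>C\<bar>"] h_bound by auto
  then have fa: "f (a \<alpha>) = h \<alpha>" if "\<alpha> \<in> L" for \<alpha>
    using a that by simp
  have lim: "limit_functional U (\<lambda>\<xi>. a (y \<xi> j)) f = (case j of None \<Rightarrow> 0 | Some i \<Rightarrow> x i)"
    if j: "j \<in> ?J" for j
  proof (intro limit_functional_eqI[OF U(1) f] tendsto_eventually)
    show "eventually (\<lambda>\<xi>. f (a (y \<xi> j)) = (case j of None \<Rightarrow> 0 | Some i \<Rightarrow> x i)) U"
      using U(2) by eventually_elim (use y(2) h_y fa j in metis)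
  qed
  have "limit_differences I U (\<lambda>\<xi>. a (y \<xi> None)) (\<lambda>i \<xi>. a (y \<xi> (Some i))) f = x"
  proof (rule extensionalityI)
    show "x \<in> extensional I" using x by (simp add: carrier_linf_iff)
  qed (simp_all add: limit_differences_def lim)
  with f show ?thesis by blast
qed

end

theorem theorem4p6:
  fixes scl :: "'k::real_or_complex \<Rightarrow> 'a::{real_normed_algebra,banach} \<Rightarrow> 'a"
    and \<eta> :: "'i rel"
    and L :: "'l set" and le :: "'l rel" and a :: "'l \<Rightarrow> 'a"
  assumes "banach_algebra scl"
    and "Cinfinite \<eta>"
    and "weak_TI_net L le a"
    and "true_card L le =o \<eta>"
    and "inj_on a L"
    and "l1_base scl \<eta> (a ` L)"
  shows "(\<exists>T. bounded_linear_map (quotient_space (Dual scl) (WAP scl)) (linf (Field \<eta>)) T \<and>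
            T ` carrier (quotient_space (Dual scl) (WAP scl)) = carrier (linf (Field \<eta>))) \<and>
         \<not> arens_regular scl \<and>
         (density_character TYPE('a) =o \<eta> \<longrightarrow> extremely_non_arens_regular scl)"
proof -
  interpret banach_algebra scl by fact
  let ?I = "Field \<eta>" and ?D = "carrier (Dual scl)"
  let ?J = "insert None (Some ` ?I)"
  have inf: "\<not> finite ?I" and Card: "Card_order \<eta>" using assms(2) by (auto simp: cinfinite_def)
  then have I: "?I \<noteq> {}" by auto
  have "|L| =o |a ` L|"
    using assms(5) by (auto simp: card_of_ordIso[symmetric] intro: inj_on_imp_bij_betw)
  moreover have "|a ` L| =o \<eta>" using assms(6) by (simp add: l1_base_def)
  ultimately have L_card: "|L| =o \<eta>" by (rule ordIso_transitive)
  have L: "L \<noteq> {}"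
  proof
    assume "L = {}"
    then have "|{} :: 'l set| =o |?I|"
      using L_card card_of_Field_ordIso[OF Card] by (metis ordIso_symmetric ordIso_transitive)
    with I show False using card_of_empty3 card_of_ordIso bij_betw_empty2 by (metis bij_betw_empty1)
  qed
  \<comment> \<open>The true cardinality is a minimum, attained by some strict upper set, and hence
    a lower bound for all of them.\<close>
  have upper: "\<eta> \<le>o |strict_upper L le \<xi>|" if "\<xi> \<in> L" for \<xi>
  proof -
    obtain S where S: "true_card L le = |S|" "\<And>\<xi>. \<xi> \<in> L \<Longrightarrow> |S| \<le>o |strict_upper L le \<xi>|"
      using least_card_attained[of "strict_upper L le ` L"] L by (auto simp: true_card_def)
    have "\<eta> =o |S|" using assms(4) S(1) by (simp add: ordIso_symmetric)
    from ordIso_ordLeq_trans[OF this S(2)[OF that]] show ?thesis .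
  qed
  \<comment> \<open>One slot per coordinate and one for the base point: as \<eta> is infinite, the
    extra slot does not raise the cardinality.\<close>
  have "|Some ` ?I| \<le>o \<eta>"
    using card_of_image card_of_Field_ordIso[OF Card] by (rule ordLeq_ordIso_trans)
  moreover have "|{None :: 'i option}| \<le>o \<eta>"
    using Card I by (rule Card_order_singl_ordLeq)
  ultimately have "|{None} \<union> Some ` ?I| \<le>o \<eta>"
    by (intro card_of_Un_ordLeq_infinite_Field[OF inf] Card)
  then have "|?J| \<le>o \<eta>" by simp
  from disjoint_cofinal_maps[OF assms(2) ordIso_imp_ordLeq[OF L_card] this upper]
  obtain y where y_inj: "inj_on (\<lambda>(\<xi>, j). y \<xi> j) (L \<times> ?J)"
    and y_upper: "\<And>\<xi> j. \<xi> \<in> L \<Longrightarrow> j \<in> ?J \<Longrightarrow> y \<xi> j \<in> strict_upper L le \<xi>" by blast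
  have y_L: "y \<xi> j \<in> L" if "\<xi> \<in> L" "j \<in> ?J" for \<xi> j
    using y_upper[OF that] by (simp add: strict_upper_def)
  have dir: "directed_set L le" and "bounded (a ` L)"
    using assms(3) by (auto simp: weak_TI_net_def)
  then obtain M where M: "\<And>\<alpha>. \<alpha> \<in> L \<Longrightarrow> norm (a \<alpha>) \<le> M" by (auto simp: bounded_iff)
  obtain U where U: "ultrafilter U" "U \<le> tails L le"
    using ultrafilter_finer_exists[OF tails_nontrivial[OF dir L]] by blast
  have "eventually (\<lambda>\<xi>. \<xi> \<in> L) (tails L le)"
    using L by (auto simp: eventually_tails[OF dir L])
  then have UL: "eventually (\<lambda>\<xi>. \<xi> \<in> L) U" using U(2) by (rule filter_leD[rotated])
  let ?b = "\<lambda>\<xi>. a (y \<xi> None)" and ?c = "\<lambda>i \<xi>. a (y \<xi> (Some i))"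
  have abs: "absorbing_nets scl U ?b (?c i) M" if "i \<in> ?I" for i
    using that by (intro weak_TI_net_absorbing[OF assms(3) L M U] y_upper) auto
  have onto: "\<exists>f\<in>?D. limit_differences ?I U ?b ?c f = x" if "x \<in> carrier (linf ?I)" for x
    by (rule limit_differences_onto[OF U(1) UL assms(6,5) y_inj y_L that])
  have blm: "bounded_linear_map (Dual scl) (linf ?I) (limit_differences ?I U ?b ?c)"
    by (rule limit_differences_bounded_linear_map[OF I abs])
  from WAP_quotient_lift[OF this limit_differences_add_WAP[OF abs]]
  obtain S where S: "bounded_linear_map WAP_quotient (linf ?I) S"
    and S_coset: "\<And>f. f \<in> ?D \<Longrightarrow> S (coset f) = limit_differences ?I U ?b ?c f" by blast
  have S_onto: "S ` carrier WAP_quotient = carrier (linf ?I)"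
  proof
    show "S ` carrier WAP_quotient \<subseteq> carrier (linf ?I)"
      using S by (auto simp: bounded_linear_map_def)
    show "carrier (linf ?I) \<subseteq> S ` carrier WAP_quotient"
    proof
      fix x :: "'i \<Rightarrow> 'k" assume "x \<in> carrier (linf ?I)"
      with onto obtain f where "f \<in> ?D" "limit_differences ?I U ?b ?c f = x" by blast
      then show "x \<in> S ` carrier WAP_quotient"
        by (intro image_eqI[of _ _ "coset f"]) (simp_all add: S_coset carrier_WAP_quotient)
    qed
  qed
  have "\<not> arens_regular scl"
  proof -
    obtain i where i: "i \<in> ?I" using I by blast
    \<comment> \<open>A preimage of the constant family 1 separates the limit along the base point
      from the limit along any other subnet.\<close>
    have "(\<lambda>i\<in>?I. 1) \<in> carrier (linf ?I)" by (auto simp: carrier_linf_iff)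
    from onto[OF this] obtain f where f: "f \<in> ?D" "limit_differences ?I U ?b ?c f = (\<lambda>i\<in>?I. 1)" by blast
    from fun_cong[OF f(2), of i] i have "limit_functional U (?c i) f - limit_functional U ?b f = 1"
      by (simp add: limit_differences_def)
    then have "limit_functional U ?b f \<noteq> limit_functional U (?c i) f" by auto
    with absorbing_nets.not_arens_regular[OF abs[OF i] f(1)] show ?thesis .
  qed
  moreover have "extremely_non_arens_regular scl" if dens: "density_character TYPE('a) =o \<eta>"
  proof -
    have "{D :: 'a set. closure D = UNIV} \<noteq> {}" using closure_UNIV by blast
    from least_card_attained[OF this] obtain D :: "'a set"
      where D: "closure D = UNIV" "density_character TYPE('a) = |D|"
      by (auto simp: density_character_def)
    \<comment> \<open>A smallest dense set is reindexed by the field of \<eta>, so that sampling on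
      it lands in the very space onto which \<open>S\<close> maps.\<close>
    have "|?I| =o |D|"
      using dens card_of_Field_ordIso[OF Card] D(2) by (metis ordIso_symmetric ordIso_transitive)
    then obtain d where "bij_betw d ?I D" by (auto simp: card_of_ordIso[symmetric])
    then have "closure (d ` ?I) = UNIV" using D(1) by (simp add: bij_betw_def)
    from extremely_non_arens_regularI[OF this I S S_onto] show ?thesis .
  qed
  ultimately show ?thesis using S S_onto by blast
qed

end
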